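(* There is an absolute constant $d$ such that for every $N\ge1$ and every $X\in\{0,1\}^N$, $$C_{GP}(X)\le C_{OP}(Y)+d\log^2 N,$$ where $Y=X_0X_1\cdots X_{M-1}$ is the prefix of $X$ of length $M$, with $M$ defined as follows: if $X$ has equally many zeros and ones then $M=N$; otherwise $M$ is the (1-indexed) position in $X$ of the $(\lfloor N/2\rfloor+1)$-st bit whose value equals the majority value of $X$.
   Context: Logarithms are base $2$. Both algorithms below maintain a list $\mathcal S=(S_1,\dots,S_\ell)$ of disjoint subsets of $\{0,\dots,N-1\}$ ("blocks") on which $X$ is known to be constant; $X_{S_j}$ denotes that common value, and initially $\mathcal S=(\{0\},\{1\},\dots,\{N-1\})$. Oblivious-pairing algorithm: COMBINE$(\mathcal S,i)$ queries $X_a\oplus X_b$ for some $a\in S_i$, $b\in S_{i+1}$; if $0$, it replaces $S_i,S_{i+1}$ by $S_i\cup S_{i+1}$ at that position, otherwise it removes both. For $k=1,\dots,\lfloor\log N\rfloor$ in turn: while some $j<\ell$ has $|S_j|=|S_{j+1}|=2^{k-1}$, apply COMBINE$(\mathcal S,j)$ for the smallest such $j$. Finally output "tie" if $\mathcal S$ is empty, else $X_{S_1}$. Greedy-pairing algorithm: COMBINE$(\mathcal S,i)$ queries $X_a\oplus X_b$ for some $a\in S_i,b\in S_{i+1}$; if $0$, it replaces $S_i,S_{i+1}$ by $S_i\cup S_{i+1}$ at that position; otherwise, if $|S_i|>|S_{i+1}|$ it removes $|S_{i+1}|$ elements from $S_i$ and removes $S_{i+1}$ from the list, and if $|S_i|=|S_{i+1}|$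 it removes both. Let $s_1$ be the largest integer $t$ with $2^t$ dividing $|S_1|$ and $s_j=\log|S_j|$ for $j\ge2$ (these blocks have power-of-two sizes). While $\ell>0$ and $|S_1|\le\sum_{j=2}^{\ell}|S_j|$: let $i$ be the smallest $j$ with $s_j=s_{j+1}$; if $\sum_{j=1}^{i}|S_j|>\sum_{j=i+1}^{\ell}|S_j|$ reset $i:=1$; apply COMBINE$(\mathcal S,i)$. Finally output "tie" if $\mathcal S$ is empty, else $X_{S_1}$. $C_{OP}(X)$ and $C_{GP}(X)$ denote the number of XOR queries (COMBINE operations) made on input $X$ by the oblivious-pairing and greedy-pairing algorithms respectively (for inputs of the corresponding length). *)

theory Defs
  imports Complex_Main
begin

text \<open>Inputs are bit strings X of length N, represented as bool lists (True = 1).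
Blocks are lists of indices (nat list); a list of blocks is a nat list list.
Positions in the block list are 0-indexed here (paper: 1-indexed).
The queried elements a, b of a COMBINE are the first elements of the two blocks.\<close>

definition init_blocks :: "nat \<Rightarrow> nat list list" where
  "init_blocks N = map (\<lambda>i. [i]) [0..<N]"

definition query :: "bool list \<Rightarrow> nat list \<Rightarrow> nat list \<Rightarrow> bool" where
  "query X a b = (X ! hd a \<noteq> X ! hd b)"

definition combine_op :: "bool list \<Rightarrow> nat list list \<Rightarrow> nat \<Rightarrow> nat list list" where
  "combine_op X S i =
     (if \<not> query X (S ! i) (S ! (i+1))
      then take i S @ [S ! i @ S ! (i+1)] @ drop (i+2) S
      else take i S @ drop (i+2) S)"

definition op_pair_exists :: "nat \<Rightarrow> nat list list \<Rightarrow> nat \<Rightarrow> bool" where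
  "op_pair_exists k S j = (j + 1 < length S \<and> length (S ! j) = 2^(k-1) \<and> length (S ! (j+1)) = 2^(k-1))"

text \<open>One phase k of the oblivious-pairing algorithm. Returns final blocks and the number
of COMBINE operations. The fuel argument is only a termination device: each COMBINE
strictly decreases the number of blocks, so fuel = length S is never exhausted.\<close>
fun op_phase :: "bool list \<Rightarrow> nat \<Rightarrow> nat \<Rightarrow> nat list list \<Rightarrow> nat list list \<times> nat" where
  "op_phase X k 0 S = (S, 0)"
| "op_phase X k (Suc f) S =
     (if \<exists>j. op_pair_exists k S j
      then (let j = (LEAST j. op_pair_exists k S j);
                (S', c) = op_phase X k f (combine_op X S j)
            in (S', Suc c))
      else (S, 0))"

definition op_run :: "bool list \<Rightarrow> nat \<Rightarrow> nat list list \<Rightarrow> nat list list \<times> nat" where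
  "op_run X K S0 = foldl (\<lambda>(S, c) k. (case op_phase X k (length S) S of (S', c') \<Rightarrow> (S', c + c')))
                        (S0, 0) [1..<Suc K]"

definition C_OP :: "bool list \<Rightarrow> nat" where
  "C_OP X = snd (op_run X (nat \<lfloor>log 2 (real (length X))\<rfloor>) (init_blocks (length X)))"

definition combine_gp :: "bool list \<Rightarrow> nat list list \<Rightarrow> nat \<Rightarrow> nat list list" where
  "combine_gp X S i =
     (if \<not> query X (S ! i) (S ! (i+1))
      then take i S @ [S ! i @ S ! (i+1)] @ drop (i+2) S
      else if length (S ! i) > length (S ! (i+1))
      then take i S @ [drop (length (S ! (i+1))) (S ! i)] @ drop (i+2) S
      else take i S @ drop (i+2) S)"

definition val2 :: "nat \<Rightarrow> nat" where
  "val2 n = (GREATEST t. 2^t dvd n)"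

definition gp_s :: "nat list list \<Rightarrow> nat \<Rightarrow> nat" where
  "gp_s S j = (if j = 0 then val2 (length (S ! 0)) else nat \<lfloor>log 2 (real (length (S ! j)))\<rfloor>)"

definition gp_cand :: "nat list list \<Rightarrow> nat \<Rightarrow> bool" where
  "gp_cand S j = (j + 1 < length S \<and> gp_s S j = gp_s S (j+1))"

definition gp_index :: "nat list list \<Rightarrow> nat" where
  "gp_index S =
     (let i = (if \<exists>j. gp_cand S j then (LEAST j. gp_cand S j) else 0)
      in if sum_list (map length (take (i+1) S)) > sum_list (map length (drop (i+1) S))
         then 0 else i)"

text \<open>Number of COMBINE operations of the greedy-pairing loop (fuel only for termination;
each COMBINE strictly decreases the number of blocks).\<close>
fun gp_loop :: "bool list \<Rightarrow> nat \<Rightarrow> nat list list \<Rightarrow> nat" where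
  "gp_loop X 0 S = 0"
| "gp_loop X (Suc f) S =
     (if S \<noteq> [] \<and> length (hd S) \<le> sum_list (map length (tl S))
      then Suc (gp_loop X f (combine_gp X S (gp_index S)))
      else 0)"

definition C_GP :: "bool list \<Rightarrow> nat" where
  "C_GP X = gp_loop X (length X) (init_blocks (length X))"

definition majority :: "bool list \<Rightarrow> bool" where
  "majority X = (count_list X True > count_list X False)"

definition prefix_len :: "bool list \<Rightarrow> nat" where
  "prefix_len X =
     (if count_list X True = count_list X False then length X
      else (LEAST m. count_list (take m X) (majority X) = length X div 2 + 1))"

end

theory Submission
  imports Defs
begin

text \<open>Oblivious pairing costs as much as its depth-first variant, which pushes the bits one by one
onto a stack of blocks of increasing powers of two. Greedy pairing simulates this stack machine,
except that its first block represents several merged blocks \<open>T\<close> of the stack, starting with the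
oldest one, the leader. A query caused by a reset to \<open>i = 1\<close> adds a block to \<open>T\<close>; such an extra query
is refunded when later a block of \<open>T\<close> is combined with the next one, which greedy pairing gets for
free. The refund is lost only if two blocks of opposite values cancel inside \<open>T\<close>.

Such a cancellation is rare. Let \<open>n\<close> be the number of unread bits and \<open>F\<close> be \<open>n\<close> minus the signed
weight of the stack, relative to the value of the leader. After a reset, \<open>F\<close> is less than 4 times
the smallest block in \<open>T\<close>, while \<open>F\<close> never increases and drops by at least \<open>2 * 2 ^ s\<close> between cancellations
at level \<open>s\<close>. So each leader sees only boundedly many cancellations per level. In the same way,
\<open>n\<close> is less than twice the leader after a reset, so boundedly many such leaders are cancelled per
level. This gives \<open>O(log^2 N)\<close> lost refunds.

Beyond the prefix \<open>Y\<close> the signed weight of the stack exceeds \<open>n\<close>, hence all queries are resets.\<close>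

subsection \<open>Oblivious pairing as a stack machine\<close>

text \<open>A stack lists its blocks from the most recent one down to the oldest one (the leader); a pair
\<open>(l, v)\<close> stands for a block of \<open>2 ^ l\<close> indices at which the input has value \<open>v\<close>.\<close>

fun push :: "nat \<Rightarrow> bool \<Rightarrow> (nat \<times> bool) list \<Rightarrow> (nat \<times> bool) list" where
  "push l v [] = [(l, v)]"
| "push l v ((k, w) # st) =
     (if k = l then if w = v then push (Suc l) v st else st else (l, v) # (k, w) # st)"

fun push_cost :: "nat \<Rightarrow> bool \<Rightarrow> (nat \<times> bool) list \<Rightarrow> nat" where
  "push_cost l v [] = 0"
| "push_cost l v ((k, w) # st) =
     (if k = l then if w = v then Suc (push_cost (Suc l) v st) else 1 else 0)"

fun run_cost :: "nat \<Rightarrow> (nat \<times> bool) list \<Rightarrow> bool list \<Rightarrow> nat" where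
  "run_cost k st [] = 0"
| "run_cost k st (x # xs) = push_cost k x st + run_cost k (push k x st) xs"

text \<open>One phase seen on the values of its blocks. An unpaired last value is dropped, as its
  block takes no part in later phases.\<close>

fun pairs :: "bool list \<Rightarrow> bool list" where
  "pairs (a # b # xs) = (if a = b then a # pairs xs else pairs xs)"
| "pairs xs = []"

lemma push_above:
  assumes "\<forall>b\<in>set st. k < fst b" "k < l"
  shows "\<forall>b\<in>set (push l v st). k < fst b"
  using assms by (induction l v st rule: push.induct) auto

lemma push_free:
  assumes "\<forall>b\<in>set st. k < fst b"
  shows "push k v st = (k, v) # st" "push_cost k v st = 0"
  using assms by (cases st; auto)+

text \<open>Blocks of the lowest level meet only each other, so pairing level by level costs the same as
pairing depth first.\<close>

lemma run_cost_pairs: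
  assumes "\<forall>b\<in>set st. k < fst b"
  shows "run_cost k st xs = length xs div 2 + run_cost (Suc k) st (pairs xs)"
  using assms
proof (induction xs arbitrary: st rule: pairs.induct)
  case (1 a b xs)
  have "\<forall>c\<in>set (push (Suc k) a st). k < fst c"
    using push_above[OF "1.prems", of "Suc k"] by simp
  then show ?case
    using 1 by (simp add: push_free)
qed (auto simp: push_free)

lemma length_pairs: "2 * length (pairs xs) \<le> length xs"
  by (induction xs rule: pairs.induct) auto

section \<open>Phases of oblivious pairing on block lists\<close>

definition is_block :: "bool list \<Rightarrow> nat \<times> bool \<Rightarrow> nat list \<Rightarrow> bool" where
  "is_block X b bl \<longleftrightarrow> length bl = 2 ^ fst b \<and> (\<forall>a\<in>set bl. X ! a = snd b)"

lemma is_block_nonempty: "is_block X b bl \<Longrightarrow> bl \<noteq> []"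
  by (auto simp: is_block_def)

lemma is_block_query:
  assumes "is_block X b bl" "is_block X c cl"
  shows "query X bl cl \<longleftrightarrow> snd b \<noteq> snd c"
  using assms is_block_nonempty[OF assms(1)] is_block_nonempty[OF assms(2)]
  by (auto simp: is_block_def query_def)

lemma is_block_append:
  assumes "is_block X (l, v) bl" "is_block X (l, v) cl"
  shows "is_block X (Suc l, v) (bl @ cl)"
  using assms by (auto simp: is_block_def)

lemma list_all2_block_length:
  "list_all2 (is_block X) (map (Pair k) ds) Ds \<Longrightarrow> D \<in> set Ds \<Longrightarrow> length D = 2 ^ k"
  by (fastforce simp: list_all2_conv_all_nth in_set_conv_nth is_block_def)

lemma no_op_pair:
  assumes "S = Ds @ Es @ Rs" "length Es \<le> 1"
    and "\<And>D. D \<in> set Ds \<Longrightarrow> length D \<noteq> 2 ^ k" "\<And>R. R \<in> set Rs \<Longrightarrow> length R \<noteq> 2 ^ k"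
  shows "\<not> op_pair_exists (Suc k) S j"
proof
  assume j: "op_pair_exists (Suc k) S j"
  have "i = length Ds" if "i < length S" "length (S ! i) = 2 ^ k" for i
  proof -
    have "\<not> i < length Ds"
      using that(2) assms(3)[of "Ds ! i"] by (auto simp: assms(1) nth_append)
    moreover have "i < length Ds + length Es"
    proof (rule ccontr)
      assume "\<not> ?thesis"
      then have "S ! i \<in> set Rs" using that(1) by (auto simp: assms(1) nth_append)
      then show False using assms(4) that(2) by blast
    qed
    ultimately show ?thesis using assms(2) by linarith
  qed
  from this[of j] this[of "Suc j"] j show False by (auto simp: op_pair_exists_def)
qed

text \<open>Loop invariant of a phase: \<open>Ds\<close> is already built, \<open>Es\<close> is
  still to be paired, \<open>Rs\<close> was left over at smaller levels. The leftmost pair always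
  starts right after \<open>Ds\<close>, and an unpaired end of \<open>Es\<close> joins the
  leftovers.\<close>

lemma op_phase_blocks:
  assumes "length S \<le> f"
    and "S = Ds @ Es @ Rs"
    and "list_all2 (is_block X) (map (Pair (Suc k)) ds) Ds"
    and "list_all2 (is_block X) (map (Pair k) es) Es"
    and "\<forall>r\<in>set Rs. length r < 2 ^ k"
  shows "\<exists>Ds' Rs'. op_phase X (Suc k) f S = (Ds' @ Rs', length es div 2)
     \<and> list_all2 (is_block X) (map (Pair (Suc k)) (ds @ pairs es)) Ds'
     \<and> (\<forall>r\<in>set Rs'. length r < 2 ^ Suc k)"
  using assms
proof (induction es arbitrary: f S Ds Es ds rule: pairs.induct)
  case (1 a b es)
  obtain A B Es' where Es: "Es = A # B # Es'" and A: "is_block X (k, a) A" and B: "is_block X (k, b) B"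
    and Es': "list_all2 (is_block X) (map (Pair k) es) Es'"
    using "1.prems"(4) by (auto simp: list_all2_Cons1)
  have S: "S = Ds @ A # B # Es' @ Rs" using "1.prems"(2) Es by simp
  have D: "length D = 2 ^ Suc k" if "D \<in> set Ds" for D
    using "1.prems"(3) that by (fastforce simp: list_all2_conv_all_nth in_set_conv_nth is_block_def)
  have lA: "length A = 2 ^ k" and lB: "length B = 2 ^ k" using A B by (auto simp: is_block_def)
  have pj: "op_pair_exists (Suc k) S (length Ds)"
    by (auto simp: op_pair_exists_def S lA lB nth_append)
  have least: "(LEAST j. op_pair_exists (Suc k) S j) = length Ds"
  proof (rule Least_equality)
    show "op_pair_exists (Suc k) S (length Ds)" by (rule pj)
    fix j assume j: "op_pair_exists (Suc k) S j"
    show "length Ds \<le> j"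
    proof (rule ccontr)
      assume "\<not> length Ds \<le> j"
      then have "S ! j \<in> set Ds" by (simp add: S nth_append)
      then show False using D j by (fastforce simp: op_pair_exists_def)
    qed
  qed
  obtain f' where f: "f = Suc f'" using "1.prems"(1) S by (cases f) auto
  have q: "query X A B \<longleftrightarrow> a \<noteq> b" using is_block_query[OF A B] by simp
  define S' where "S' = combine_op X S (length Ds)"
  have step: "op_phase X (Suc k) f S = (let (S'', c) = op_phase X (Suc k) f' S' in (S'', Suc c))"
    using pj least by (auto simp: f S'_def Let_def)
  show ?case
  proof (cases "a = b")
    case True
    have S': "S' = (Ds @ [A @ B]) @ Es' @ Rs"
      using q True by (simp add: S'_def combine_op_def S nth_append)
    have "list_all2 (is_block X) (map (Pair (Suc k)) (ds @ [a])) (Ds @ [A @ B])"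
      using "1.prems"(3) is_block_append A B True by (auto intro!: list_all2_appendI)
    moreover have "length S' \<le> f'" using "1.prems"(1) S S' f by simp
    ultimately obtain Ds' Rs' where ih: "op_phase X (Suc k) f' S' = (Ds' @ Rs', length es div 2)"
      "list_all2 (is_block X) (map (Pair (Suc k)) ((ds @ [a]) @ pairs es)) Ds'"
      "\<forall>r\<in>set Rs'. length r < 2 ^ Suc k"
      using "1.IH"(1)[OF True _ S' _ Es' "1.prems"(5)] by blast
    have "op_phase X (Suc k) f S = (Ds' @ Rs', length (a # b # es) div 2)"
      using step ih(1) by simp
    moreover have "list_all2 (is_block X) (map (Pair (Suc k)) (ds @ pairs (a # b # es))) Ds'"
      using ih(2) True by simp
    ultimately show ?thesis using ih(3) by blast
  next
    case False
    have S': "S' = Ds @ Es' @ Rs"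
      using q False by (simp add: S'_def combine_op_def S nth_append)
    moreover have "length S' \<le> f'" using "1.prems"(1) S S' f by simp
    ultimately obtain Ds' Rs' where ih: "op_phase X (Suc k) f' S' = (Ds' @ Rs', length es div 2)"
      "list_all2 (is_block X) (map (Pair (Suc k)) (ds @ pairs es)) Ds'"
      "\<forall>r\<in>set Rs'. length r < 2 ^ Suc k"
      using "1.IH"(2)[OF False _ S' "1.prems"(3) Es' "1.prems"(5)] by blast
    have "op_phase X (Suc k) f S = (Ds' @ Rs', length (a # b # es) div 2)"
      using step ih(1) by simp
    moreover have "list_all2 (is_block X) (map (Pair (Suc k)) (ds @ pairs (a # b # es))) Ds'"
      using ih(2) False by simp
    ultimately show ?thesis using ih(3) by blast
  qed
next
  case ("2_1")
  have "\<not> op_pair_exists (Suc k) S j" for j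
    using "2_1.prems" by (intro no_op_pair[of S Ds Es Rs]) (auto dest: list_all2_block_length)
  then have "op_phase X (Suc k) f S = (S, 0)" by (cases f) auto
  with "2_1.prems" show ?case by fastforce
next
  case ("2_2" e)
  have "\<not> op_pair_exists (Suc k) S j" for j
    using "2_2.prems" by (intro no_op_pair[of S Ds Es Rs]) (auto dest: list_all2_block_length simp: list_all2_Cons1)
  then have "op_phase X (Suc k) f S = (S, 0)" by (cases f) auto
  moreover have "\<forall>r\<in>set (Es @ Rs). length r < 2 ^ Suc k"
    using "2_2.prems"(4,5) by (auto simp: list_all2_Cons1 is_block_def)
  ultimately show ?case
    using "2_2.prems"(2,3) by (intro exI[of _ Ds] exI[of _ "Es @ Rs"]) simp
qed

lemma op_run_Suc:
  "op_run X (Suc K) S = (case op_run X K S of (S1, c) \<Rightarrow>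
     case op_phase X (Suc K) (length S1) S1 of (S2, c') \<Rightarrow> (S2, c + c'))"
  by (simp add: op_run_def split: prod.splits)

text \<open>The cost of the stack machine splits into the phases already done and a run on the
  values still in play. The length bound leaves fewer than two such values after the last
  phase.\<close>

lemma op_run_blocks:
  "\<exists>Ds Rs ds. fst (op_run Y K (init_blocks (length Y))) = Ds @ Rs
     \<and> list_all2 (is_block Y) (map (Pair K) ds) Ds
     \<and> (\<forall>r\<in>set Rs. length r < 2 ^ K)
     \<and> 2 ^ K * length ds \<le> length Y
     \<and> snd (op_run Y K (init_blocks (length Y))) + run_cost K [] ds = run_cost 0 [] Y"
proof (induction K)
  case 0
  have "list_all2 (is_block Y) (map (Pair 0) Y) (init_blocks (length Y))"
    by (auto simp: init_blocks_def list_all2_conv_all_nth is_block_def)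
  then show ?case by (intro exI[of _ "init_blocks (length Y)"] exI[of _ "[]"] exI[of _ Y]) (simp add: op_run_def)
next
  case (Suc K)
  then obtain Ds Rs ds c where IH: "op_run Y K (init_blocks (length Y)) = (Ds @ Rs, c)"
    "list_all2 (is_block Y) (map (Pair K) ds) Ds" "\<forall>r\<in>set Rs. length r < 2 ^ K"
    "2 ^ K * length ds \<le> length Y" "c + run_cost K [] ds = run_cost 0 [] Y"
    by (metis prod.collapse)
  from op_phase_blocks[OF order.refl, of "Ds @ Rs" "[]" Ds Rs Y K "[]" ds] IH(2,3)
  obtain Ds' Rs' where ph: "op_phase Y (Suc K) (length (Ds @ Rs)) (Ds @ Rs) = (Ds' @ Rs', length ds div 2)"
    "list_all2 (is_block Y) (map (Pair (Suc K)) (pairs ds)) Ds'"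
    "\<forall>r\<in>set Rs'. length r < 2 ^ Suc K" by auto
  have "2 ^ Suc K * length (pairs ds) \<le> length Y"
    using mult_le_mono2[OF length_pairs[of ds], of "2 ^ K"] IH(4)
    by (simp only: power_Suc mult.assoc mult.left_commute[of 2 "2 ^ K"])
  then show ?case
    using IH(1,5) ph run_cost_pairs[of "[]" K ds]
    by (intro exI[of _ Ds'] exI[of _ Rs'] exI[of _ "pairs ds"]) (simp add: op_run_Suc)
qed

lemma less_two_power_log: "n < 2 ^ Suc (nat \<lfloor>log 2 (real n)\<rfloor>)"
proof (cases "n = 0")
  case False
  have "log 2 (real n) < real (Suc (nat \<lfloor>log 2 (real n)\<rfloor>))" by linarith
  then have "real n < 2 powr real (Suc (nat \<lfloor>log 2 (real n)\<rfloor>))"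
    using False by (simp add: log_less_iff)
  then show ?thesis by (simp only: powr_realpow of_nat_less_numeral_power_cancel_iff zero_less_numeral)
qed simp

lemma C_OP_run_cost: "C_OP Y = run_cost 0 [] Y"
proof -
  define K where "K = nat \<lfloor>log 2 (real (length Y))\<rfloor>"
  obtain ds where ds: "2 ^ K * length ds \<le> length Y"
    "snd (op_run Y K (init_blocks (length Y))) + run_cost K [] ds = run_cost 0 [] Y"
    using op_run_blocks[of Y K] by blast
  have "2 ^ K * length ds < 2 ^ K * 2"
    using ds(1) less_two_power_log[of "length Y", folded K_def]
    unfolding power_Suc mult.commute[of 2] by (rule le_less_trans)
  then have "length ds < 2" by (metis mult_less_cancel1)
  then have "run_cost K [] ds = 0" by (cases ds) auto
  then show ?thesis using ds(2) by (simp add: C_OP_def K_def)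
qed

subsection \<open>The potential\<close>

definition weight :: "(nat \<times> bool) list \<Rightarrow> nat" where
  "weight st = (\<Sum>b\<leftarrow>st. 2 ^ fst b)"

definition signed_sum :: "bool \<Rightarrow> (nat \<times> bool) list \<Rightarrow> int" where
  "signed_sum v st = (\<Sum>b\<leftarrow>st. if snd b = v then 2 ^ fst b else - (2 ^ fst b))"

definition low_weight :: "nat \<Rightarrow> (nat \<times> bool) list \<Rightarrow> nat" where
  "low_weight s st = (\<Sum>b\<leftarrow>st. if fst b \<le> s then 2 ^ fst b else 0)"

definition low_pos :: "bool \<Rightarrow> nat \<Rightarrow> (nat \<times> bool) list \<Rightarrow> nat" where
  "low_pos v s st = (\<Sum>b\<leftarrow>st. if fst b \<le> s \<and> snd b = v then 2 ^ fst b else 0)"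

lemmas stack_sums = weight_def signed_sum_def low_weight_def low_pos_def

text \<open>The quantity \<open>F\<close> of the introduction. Combining two blocks of equal level
  leaves it unchanged; reading a bit of value \<open>v\<close> lowers it by 2, reading any other bit
  keeps it.\<close>

definition slack :: "bool \<Rightarrow> (nat \<times> bool) list \<Rightarrow> nat \<Rightarrow> int" where
  "slack v st n = int n - signed_sum v st"

text \<open>For a fixed leader of value \<open>v\<close>, the quantity below never increases, and every cancellation
at level \<open>s\<close> lowers it by \<open>2 * 2 ^ s\<close>; the summand 2 keeps it nonnegative while a just read bit is
being combined.\<close>

definition low_slack :: "bool \<Rightarrow> (nat \<times> bool) list \<Rightarrow> nat \<Rightarrow> nat \<Rightarrow> int" where
  "low_slack v st n s = slack v st n + 2 + 2 * int (low_pos v s st)"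

text \<open>Both budgets bound the number of future cancellations level by level: those of leaders, and
those of blocks above the current leader. The caps 2 and 4 do not bind when a cancellation has to
be paid for: then \<open>n < 2 * 2 ^ s\<close>, respectively \<open>slack < 4 * 2 ^ s\<close>, holds at its level \<open>s\<close>.\<close>

definition leader_budget :: "nat \<Rightarrow> (nat \<times> bool) list \<Rightarrow> nat \<Rightarrow> nat" where
  "leader_budget L st n = (\<Sum>s\<le>L. min 2 ((n + low_weight s st) div 2 ^ Suc s))"

definition merged_budget :: "nat \<Rightarrow> bool \<Rightarrow> (nat \<times> bool) list \<Rightarrow> nat \<Rightarrow> nat" where
  "merged_budget L v st n = (\<Sum>s\<le>L. min 4 (nat (low_slack v st n s) div 2 ^ Suc s))"

definition critical :: "(nat \<times> bool) list \<Rightarrow> nat \<Rightarrow> bool" where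
  "critical st n \<longleftrightarrow> st \<noteq> [] \<and> n < 2 * 2 ^ fst (last st)"

text \<open>One unit of the leader budget is worth \<open>4 * (L + 1)\<close>, the most a merged
  budget can hold, so it can equip the next leader. A leader that is not yet critical keeps this
  full reserve.\<close>

definition cancel_budget :: "nat \<Rightarrow> (nat \<times> bool) list \<Rightarrow> nat \<Rightarrow> nat" where
  "cancel_budget L st n = 4 * (L + 1) * leader_budget L st n +
     (if critical st n then merged_budget L (snd (last st)) st n else 4 * (L + 1))"

lemma merged_budget_le: "merged_budget L v st n \<le> 4 * (L + 1)"
proof -
  have "merged_budget L v st n \<le> (\<Sum>s\<le>L. 4)" unfolding merged_budget_def by (rule sum_mono) simp
  then show ?thesis by simp
qed

lemma leader_budget_le: "leader_budget L st n \<le> 2 * (L + 1)"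
proof -
  have "leader_budget L st n \<le> (\<Sum>s\<le>L. 2)" unfolding leader_budget_def by (rule sum_mono) simp
  then show ?thesis by simp
qed

lemma cancel_budget_le: "cancel_budget L st n \<le> 4 * (L + 1) * (2 * (L + 1)) + 4 * (L + 1)"
  unfolding cancel_budget_def
  by (rule add_mono[OF mult_le_mono2[OF leader_budget_le]]) (cases "critical st n"; simp only: merged_budget_le if_True if_False order.refl)

lemma min_div_mono: "(a::nat) \<le> b \<Longrightarrow> min c (a div d) \<le> min c (b div d)"
  using div_le_mono[of a b d] by (simp add: min_def)

lemma leader_budget_mono:
  assumes "\<And>s. n' + low_weight s st' \<le> n + low_weight s st"
  shows "leader_budget L st' n' \<le> leader_budget L st n"
  unfolding leader_budget_def by (rule sum_mono) (rule min_div_mono[OF assms])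

lemma merged_budget_mono:
  assumes "\<And>s. low_slack v st' n' s \<le> low_slack v st n s"
  shows "merged_budget L v st' n' \<le> merged_budget L v st n"
  unfolding merged_budget_def by (rule sum_mono) (rule min_div_mono[OF nat_mono[OF assms]])

text \<open>If \<open>st\<close> is not critical, its full reserve covers whatever
  \<open>st'\<close> holds. Otherwise the leader's value persists and the merged budgets are
  compared termwise.\<close>

lemma cancel_budget_mono:
  assumes "\<And>s. n' + low_weight s st' \<le> n + low_weight s st"
    and "critical st n \<Longrightarrow> critical st' n'"
    and "critical st n \<Longrightarrow> snd (last st') = snd (last st)"
    and "\<And>s. critical st n \<Longrightarrow> low_slack (snd (last st)) st' n' s \<le> low_slack (snd (last st)) st n s"
  shows "cancel_budget L st' n' \<le> cancel_budget L st n"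
proof -
  have "4 * (L + 1) * leader_budget L st' n' \<le> 4 * (L + 1) * leader_budget L st n"
    by (rule mult_le_mono2[OF leader_budget_mono[OF assms(1)]])
  moreover have "merged_budget L (snd (last st)) st' n' \<le> merged_budget L (snd (last st)) st n" if "critical st n"
    using merged_budget_mono[of _ st' n' st n] assms(4) that by blast
  ultimately show ?thesis
    using assms(2,3) merged_budget_le[of L "snd (last st')" st' n'] unfolding cancel_budget_def
    by (cases "critical st n") (auto simp del: One_nat_def mult_Suc_right intro!: add_mono split: if_split)
qed

text \<open>The bit's weight passes from \<open>n\<close> to level 0, so
  \<open>n + low_weight\<close> is unchanged. If the bit has the leader's value, the loss of 2 in
  \<open>slack\<close> is balanced by \<open>2 * low_pos\<close>.\<close>

lemma cancel_budget_read: "cancel_budget L ((0, x) # st) n \<le> cancel_budget L st (Suc n)"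
  by (rule cancel_budget_mono) (auto simp: critical_def low_slack_def slack_def stack_sums)

lemma cancel_budget_merge: "cancel_budget L ((Suc l, v) # st) n \<le> cancel_budget L ((l, v) # (l, v) # st) n"
  by (rule cancel_budget_mono) (auto simp: critical_def low_slack_def slack_def stack_sums)

lemma cancel_budget_cancel:
  assumes "st \<noteq> []" "v \<noteq> w"
  shows "cancel_budget L st n \<le> cancel_budget L ((l, v) # (l, w) # st) n"
  using assms by (intro cancel_budget_mono) (auto simp: critical_def low_slack_def slack_def stack_sums)

lemma sum_less_one:
  fixes f g :: "nat \<Rightarrow> nat"
  assumes "l \<le> L" "\<And>s. f s \<le> g s" "f l < g l"
  shows "Suc (\<Sum>s\<le>L. f s) \<le> (\<Sum>s\<le>L. g s)"
  using sum_strict_mono_ex1[of "{..L}" f g] assms by (auto simp: Suc_le_eq)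

text \<open>For a critical leader \<open>n < 2 ^ Suc l\<close>, so without the two blocks the
  quotient at level \<open>l\<close> falls to 0, and the freed unit refills the reserve. A
  noncritical leader hands its reserve on.\<close>

lemma cancel_budget_leader_cancel:
  assumes "l \<le> L" "v \<noteq> w"
  shows "cancel_budget L [] n \<le> cancel_budget L [(l, v), (l, w)] n"
proof (cases "critical [(l, v), (l, w)] n")
  case True
  then have n: "n < 2 ^ Suc l" by (simp add: critical_def)
  have "Suc (leader_budget L [] n) \<le> leader_budget L [(l, v), (l, w)] n"
    unfolding leader_budget_def
  proof (rule sum_less_one[OF assms(1)])
    show "min 2 ((n + low_weight s []) div 2 ^ Suc s)
        \<le> min 2 ((n + low_weight s [(l, v), (l, w)]) div 2 ^ Suc s)" for s
      by (rule min_div_mono) (simp add: low_weight_def)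
    have "(n + low_weight l []) div 2 ^ Suc l = 0" using n by (simp add: low_weight_def)
    moreover have "(n + low_weight l [(l, v), (l, w)]) div 2 ^ Suc l \<ge> 1"
      by (simp add: low_weight_def Suc_le_eq div_greater_zero_iff)
    ultimately show "min 2 ((n + low_weight l []) div 2 ^ Suc l)
        < min 2 ((n + low_weight l [(l, v), (l, w)]) div 2 ^ Suc l)"
      by linarith
  qed
  then have "4 * (L + 1) * Suc (leader_budget L [] n) \<le> 4 * (L + 1) * leader_budget L [(l, v), (l, w)] n"
    by (rule mult_le_mono2)
  then show ?thesis by (simp add: cancel_budget_def critical_def)
next
  case False
  have "leader_budget L [] n \<le> leader_budget L [(l, v), (l, w)] n"
    by (rule leader_budget_mono) (simp add: low_weight_def)
  then have "4 * (L + 1) * leader_budget L [] n \<le> 4 * (L + 1) * leader_budget L [(l, v), (l, w)] n"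
    by (rule mult_le_mono2)
  then show ?thesis using False by (simp add: cancel_budget_def critical_def)
qed

lemma low_pos_above: "\<forall>b\<in>set st. s < fst b \<Longrightarrow> low_pos v s st = 0"
  by (induction st) (auto simp: low_pos_def)

text \<open>Exactly one of the two blocks counts in \<open>low_pos\<close>, so their cancellation
  lowers the low slack at level \<open>l\<close> by \<open>2 ^ Suc l\<close> and the quotient by 1.
  The bound \<open>lo\<close> keeps \<open>nat\<close> exact, and \<open>hi\<close> keeps the
  quotient below the cap 4.\<close>

lemma cancel_budget_inner_cancel:
  assumes "l \<le> L" "v \<noteq> w" "st \<noteq> []" "\<forall>b\<in>set st. l < fst b"
    and crit: "critical st n"
    and lo: "- 2 \<le> slack (snd (last st)) st n"
    and hi: "slack (snd (last st)) st n < 4 * 2 ^ l"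
  shows "Suc (cancel_budget L st n) \<le> cancel_budget L ((l, v) # (l, w) # st) n"
proof -
  let ?u = "snd (last st)" and ?st = "(l, v) # (l, w) # st"
  have sl: "low_slack ?u ?st n s = low_slack ?u st n s + (if l \<le> s then 2 * 2 ^ l else 0)" for s
    using assms(2) by (auto simp: low_slack_def slack_def stack_sums)
  have "Suc (merged_budget L ?u st n) \<le> merged_budget L ?u ?st n"
    unfolding merged_budget_def
  proof (rule sum_less_one[OF assms(1)])
    show "min 4 (nat (low_slack ?u st n s) div 2 ^ Suc s)
        \<le> min 4 (nat (low_slack ?u ?st n s) div 2 ^ Suc s)" for s
      by (rule min_div_mono[OF nat_mono]) (simp add: sl)
    define a where "a = nat (low_slack ?u st n l)"
    have a: "low_slack ?u st n l = int a"
      using lo by (simp add: a_def low_slack_def)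
    have "int a < 4 * 2 ^ l + 2"
      unfolding a[symmetric] using hi by (simp add: low_slack_def low_pos_above assms(4))
    then have "int a < int (4 * 2 ^ l + 2)" by simp
    then have "a < 4 * 2 ^ l + 2" by linarith
    also have "\<dots> \<le> 3 * 2 ^ Suc l" using one_le_power[of "2::nat" l] by simp
    finally have "a div 2 ^ Suc l < 3" by (simp add: div_less_iff_less_mult mult.commute)
    moreover have "nat (low_slack ?u ?st n l) = a + 2 ^ Suc l"
      unfolding sl a by (simp add: nat_add_distrib nat_mult_distrib nat_power_eq)
    moreover have "(a + 2 ^ Suc l) div 2 ^ Suc l = a div 2 ^ Suc l + 1"
      by (rule div_add_self2) simp
    ultimately show "min 4 (nat (low_slack ?u st n l) div 2 ^ Suc l)
        < min 4 (nat (low_slack ?u ?st n l) div 2 ^ Suc l)"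
      by (simp add: a)
  qed
  moreover have "4 * (L + 1) * leader_budget L st n \<le> 4 * (L + 1) * leader_budget L ?st n"
    by (rule mult_le_mono2[OF leader_budget_mono]) (simp add: low_weight_def)
  moreover have "cancel_budget L ?st n = 4 * (L + 1) * leader_budget L ?st n + merged_budget L ?u ?st n"
    using crit by (simp add: cancel_budget_def critical_def)
  moreover have "cancel_budget L st n = 4 * (L + 1) * leader_budget L st n + merged_budget L ?u st n"
    using crit by (simp add: cancel_budget_def)
  ultimately show ?thesis by linarith
qed

section \<open>Effect of a push on the stack and on the potential\<close>

lemma push_sorted:
  assumes "sorted_wrt (<) (map fst st)" "\<forall>b\<in>set st. l \<le> fst b"
  shows "sorted_wrt (<) (map fst (push l v st)) \<and> (\<forall>b\<in>set (push l v st). l \<le> fst b)"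
  using assms
proof (induction l v st rule: push.induct)
  case (2 l v k w st)
  show ?case
  proof (cases "k = l \<and> w = v")
    case True
    then have "\<forall>b\<in>set st. Suc l \<le> fst b" using "2.prems" by (auto simp: Suc_le_eq)
    then show ?thesis using 2 True by (auto simp: Suc_le_eq intro: less_imp_le)
  qed (use 2 in \<open>auto split: if_splits\<close>)
qed auto

lemma push_signed_sum: "signed_sum u (push l v st) = signed_sum u ((l, v) # st)"
  by (induction l v st rule: push.induct) (auto simp: signed_sum_def)

lemma push_weight: "weight (push l v st) \<le> weight ((l, v) # st)"
  by (induction l v st rule: push.induct) (auto simp: weight_def)

lemma push_last:
  assumes "st \<noteq> []" "push l v st \<noteq> []"
  shows "snd (last (push l v st)) = snd (last st) \<and> fst (last st) \<le> fst (last (push l v st))"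
  using assms
proof (induction l v st rule: push.induct)
  case (2 l v k w st)
  then show ?case by (cases "st = []") (auto split: if_splits)
qed auto

text \<open>\<open>T\<close> consists of the blocks of the stack \<open>st\<close> that greedy pairing has merged into its first
block. An extra query extends \<open>T\<close> by one; a combination inside \<open>T\<close> shortens \<open>T\<close> and costs greedy
pairing no query, and a further shortening is paid for by a cancellation.\<close>

definition potential :: "nat \<Rightarrow> (nat \<times> bool) list \<Rightarrow> (nat \<times> bool) list \<Rightarrow> nat \<Rightarrow> nat" where
  "potential L T st n = L - (length T - 1) + cancel_budget L st n"

text \<open>The \<open>Suc\<close> is the one query by which greedy pairing takes in the block. A
  chain of \<open>m\<close> combinations pays for this query and for shortening \<open>T\<close> by
  \<open>m - 1\<close>. A final cancellation above the leader shortens \<open>T\<close> once more,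
  at the expense of \<open>cancel_budget\<close>.\<close>

lemma push_potential:
  assumes "T \<noteq> []" "sorted_wrt (<) (map fst T)" "fst (hd T) = l" "\<forall>b\<in>set T. fst b \<le> L"
    and "length T \<le> Suc L"
    and "length T \<ge> 2 \<Longrightarrow> critical T n"
    and "- 2 \<le> slack (snd (last T)) ((l, v) # T) n"
    and "length T \<ge> 2 \<Longrightarrow> slack (snd (last T)) ((l, v) # T) n < 4 * 2 ^ l"
  shows "Suc (potential L (push l v T) (push l v T) n)
    \<le> push_cost l v T + potential L T ((l, v) # T) n"
  using assms
proof (induction T arbitrary: l)
  case (Cons t T)
  obtain w where t: "t = (l, w)" using Cons.prems(3) by (cases t) auto
  show ?case
  proof (cases "T = []")
    case True
    show ?thesis
    proof (cases "w = v")
      case True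
      then show ?thesis using \<open>T = []\<close> cancel_budget_merge[of L l v "[]" n] by (simp add: t potential_def)
    next
      case False
      \<comment> \<open>A lone leader and an empty \<open>T\<close> give the same truncated
        \<open>length T - 1\<close>, so only the budgets have to be compared.\<close>
      then show ?thesis using \<open>T = []\<close> cancel_budget_leader_cancel[of l L v w n] Cons.prems(4)
        by (auto simp: t potential_def)
    qed
  next
    case ne: False
    have crit: "critical T n" using Cons.prems(6) ne by (cases T) (auto simp: critical_def)
    have above: "\<forall>b\<in>set T. l < fst b" using Cons.prems(2) by (auto simp: t)
    have hi: "slack (snd (last T)) ((l, v) # (l, w) # T) n < 4 * 2 ^ l"
      using Cons.prems(8) ne by (cases T) (auto simp: t)
    have lo: "- 2 \<le> slack (snd (last T)) ((l, v) # (l, w) # T) n"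
      using Cons.prems(7) ne by (simp add: t)
    show ?thesis
    proof (cases "w = v")
      case True
      have merge: "cancel_budget L ((Suc l, v) # T) n \<le> cancel_budget L ((l, v) # t # T) n"
        using cancel_budget_merge[of L l v T n] True by (simp add: t)
      have sl: "slack (snd (last T)) ((Suc l, v) # T) n = slack (snd (last T)) ((l, v) # (l, w) # T) n"
        using True by (simp add: slack_def signed_sum_def)
      show ?thesis
      proof (cases "fst (hd T) = Suc l")
        case step: True
        have "Suc (potential L (push (Suc l) v T) (push (Suc l) v T) n)
          \<le> push_cost (Suc l) v T + potential L T ((Suc l, v) # T) n"
        proof (rule Cons.IH[OF ne _ step])
          show "- 2 \<le> slack (snd (last T)) ((Suc l, v) # T) n" using lo sl by simp
          have "(4::int) * 2 ^ l \<le> 4 * 2 ^ Suc l" by simp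
          then show "slack (snd (last T)) ((Suc l, v) # T) n < 4 * 2 ^ Suc l"
            using hi sl by linarith
        qed (use Cons.prems crit in auto)
        moreover have "potential L T ((Suc l, v) # T) n \<le> Suc (potential L (t # T) ((l, v) # t # T) n)"
          using merge ne Cons.prems(5) by (cases T) (auto simp: potential_def)
        ultimately show ?thesis using True by (simp add: t)
      next
        case False
        then have p: "push (Suc l) v T = (Suc l, v) # T" "push_cost (Suc l) v T = 0"
          using ne by (cases T; auto)+
        show ?thesis using True merge by (simp add: p t potential_def)
      qed
    next
      case False
      have "slack (snd (last T)) T n = slack (snd (last T)) ((l, v) # (l, w) # T) n"
        using False by (auto simp: slack_def signed_sum_def)
      then have "Suc (cancel_budget L T n) \<le> cancel_budget L ((l, v) # (l, w) # T) n"
        using Cons.prems(4) False ne above crit lo hi by (intro cancel_budget_inner_cancel) (auto simp: t)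
      then show ?thesis using False ne Cons.prems(5)
        by (cases T) (auto simp: t potential_def)
    qed
  qed
qed simp

subsection \<open>States of greedy pairing\<close>

lemma sum_list_weight_block: "list_all2 (is_block X) Q Cs \<Longrightarrow> sum_list (map length Cs) = weight Q"
  by (induction rule: list_all2_induct) (auto simp: weight_def is_block_def)

lemma weight_rev [simp]: "weight (rev st) = weight st"
  unfolding weight_def by (induction st) simp_all

lemma weight_simps [simp]:
  "weight [] = 0" "weight (b # st) = 2 ^ fst b + weight st" "weight (st @ st') = weight st + weight st'"
  by (auto simp: weight_def)

lemma signed_sum_simps [simp]:
  "signed_sum v [] = 0"
  "signed_sum v (b # st) = (if snd b = v then 2 ^ fst b else - (2 ^ fst b)) + signed_sum v st"
  "signed_sum v (st @ st') = signed_sum v st + signed_sum v st'"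
  by (auto simp: signed_sum_def)

lemma abs_signed_sum_le: "\<bar>signed_sum v st\<bar> \<le> int (weight st)"
proof (induction st)
  case (Cons b st)
  have "\<bar>signed_sum v (b # st)\<bar> \<le> \<bar>if snd b = v then 2 ^ fst b else - (2 ^ fst b)\<bar> + \<bar>signed_sum v st\<bar>"
    unfolding signed_sum_simps by (rule abs_triangle_ineq)
  also have "\<bar>if snd b = v then 2 ^ fst b else - (2 ^ fst b)\<bar> = (2::int) ^ fst b" by simp
  finally show ?case using Cons by simp
qed simp

lemma abs_signed_sum_eq: "\<bar>signed_sum v st\<bar> = \<bar>signed_sum w st\<bar>"
proof -
  have "signed_sum v st = (if v = w then 1 else -1) * signed_sum w st"
    by (induction st) auto
  then show ?thesis by (auto simp: abs_mult)
qed

lemma weight_sorted: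
  assumes "sorted_wrt (<) (map fst st)" "st \<noteq> []"
  shows "weight st < 2 * 2 ^ fst (last st)"
  using assms
proof (induction st rule: rev_induct)
  case (snoc b st)
  show ?case
  proof (cases "st = []")
    case False
    then have "weight st < 2 * 2 ^ fst (last st)" using snoc by (auto simp: sorted_wrt_append)
    moreover have "Suc (fst (last st)) \<le> fst b"
      using snoc.prems(1) False by (auto simp: sorted_wrt_append Suc_le_eq)
    then have "(2::nat) ^ Suc (fst (last st)) \<le> 2 ^ fst b" by (rule power_increasing) simp
    ultimately show ?thesis by simp
  qed simp
qed simp

text \<open>Distinct levels let the leader outweigh all other blocks together, and all blocks but
  the smallest vanish modulo twice the smallest. The odd cofactor later yields \<open>val2\<close>
  of the first block.\<close>

lemma signed_sum_sorted:
  assumes "sorted_wrt (<) (map fst st)" "st \<noteq> []"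
  shows "2 ^ fst (hd st) \<le> signed_sum (snd (last st)) st
    \<and> (\<exists>k. signed_sum (snd (last st)) st = 2 ^ fst (hd st) * (2 * k + 1))"
  using assms
proof (induction st)
  case (Cons b st)
  show ?case
  proof (cases "st = []")
    case True
    then show ?thesis by (auto intro: exI[of _ 0])
  next
    case False
    let ?v = "snd (last st)"
    obtain k where k: "signed_sum ?v st = 2 ^ fst (hd st) * (2 * k + 1)"
      and ge: "2 ^ fst (hd st) \<le> signed_sum ?v st"
      using Cons False by auto
    have "fst b < fst (hd st)" using Cons.prems(1) False by (cases st) auto
    then obtain d where d: "fst (hd st) = Suc (fst b + d)" using less_imp_Suc_add by blast
    then have hd: "(2::int) ^ fst (hd st) = 2 ^ fst b * (2 * 2 ^ d)" by (simp add: power_add)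
    have "(2::int) ^ Suc (fst b) \<le> 2 ^ fst (hd st)" by (rule power_increasing) (use d in auto)
    moreover have "(0::int) \<le> 2 ^ fst b" by simp
    ultimately have "2 ^ fst b \<le> signed_sum ?v (b # st)"
      using ge unfolding signed_sum_simps power_Suc by (auto split: if_split simp del: zero_le_power)
    moreover have "signed_sum ?v (b # st) = 2 ^ fst b * (2 * (2 ^ d * (2 * k + 1) + (if snd b = ?v then 0 else -1)) + 1)"
      unfolding signed_sum_simps k hd by (simp add: algebra_simps)
    ultimately show ?thesis using False by (metis last_ConsR list.sel(1))
  qed
qed simp

lemma val2_eq:
  assumes "int m = 2 ^ l * (2 * k + 1)"
  shows "val2 m = l"
  unfolding val2_def
proof (rule Greatest_equality)
  have "(2::int) ^ l dvd int m" using assms by simp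
  then show "2 ^ l dvd m" by (metis of_nat_dvd_iff of_nat_numeral of_nat_power)
  fix t assume "2 ^ t dvd m"
  then have t: "(2::int) ^ t dvd int m" by (metis of_nat_dvd_iff of_nat_numeral of_nat_power)
  show "t \<le> l"
  proof (rule ccontr)
    assume "\<not> t \<le> l"
    then have "(2::int) ^ Suc l dvd 2 ^ t" by (intro le_imp_power_dvd) simp
    then have "2 ^ l * 2 dvd 2 ^ l * (2 * k + 1)" using t assms by (metis dvd_trans power_Suc2)
    then show False by simp
  qed
qed

text \<open>\<open>Q\<close> is in list order, oldest first, so a stack part \<open>B\<close> enters
  as \<open>rev B\<close>. Cancelled elements have left the first block, hence its length is a
  signed sum.\<close>

definition gp_state ::
  "bool list \<Rightarrow> (nat \<times> bool) list \<Rightarrow> (nat \<times> bool) list \<Rightarrow> nat \<Rightarrow> nat list list \<Rightarrow> bool" where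
  "gp_state X T Q p S \<longleftrightarrow> (\<exists>s Cs. S = s # Cs @ map (\<lambda>i. [i]) [p..<length X]
     \<and> list_all2 (is_block X) Q Cs \<and> (\<forall>a\<in>set s. X ! a = snd (last T))
     \<and> int (length s) = signed_sum (snd (last T)) T)"

lemma gp_stateE:
  assumes "gp_state X T Q p S"
  obtains s Cs where "S = s # Cs @ map (\<lambda>i. [i]) [p..<length X]"
    "list_all2 (is_block X) Q Cs" "\<forall>a\<in>set s. X ! a = snd (last T)"
    "int (length s) = signed_sum (snd (last T)) T"
  using assms unfolding gp_state_def by blast

text \<open>The list \<open>S\<close> stays the same: the singleton at \<open>p\<close> merely
  counts as a block of level 0 from now on, so reading makes no query.\<close>

lemma gp_state_read:
  assumes "gp_state X T Q p S" "p < length X"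
  shows "gp_state X T (Q @ [(0, X ! p)]) (Suc p) S"
proof -
  obtain s Cs where S: "S = s # Cs @ map (\<lambda>i. [i]) [p..<length X]"
    "list_all2 (is_block X) Q Cs" "\<forall>a\<in>set s. X ! a = snd (last T)"
    "int (length s) = signed_sum (snd (last T)) T"
    using assms(1) by (rule gp_stateE)
  have "list_all2 (is_block X) (Q @ [(0, X ! p)]) (Cs @ [[p]])"
    using S(2) by (auto intro!: list_all2_appendI simp: is_block_def)
  moreover have "S = s # (Cs @ [[p]]) @ map (\<lambda>i. [i]) [Suc p..<length X]"
    using S(1) assms(2) by (simp add: upt_conv_Cons)
  ultimately show ?thesis using S(3,4) unfolding gp_state_def by blast
qed

text \<open>By the odd cofactor in \<open>signed_sum_sorted\<close>, the first block shows the level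
  of the smallest block of \<open>T\<close>, so index selection sees \<open>T\<close> as its top
  block alone.\<close>

lemma gp_state_levels:
  assumes "gp_state X T Q p S" "T \<noteq> []" "sorted_wrt (<) (map fst T)"
  shows "length S = Suc (length Q + (length X - p))"
    and "j < length S \<Longrightarrow> gp_s S j = (fst (hd T) # map fst Q @ replicate (length X - p) 0) ! j"
proof -
  obtain s Cs where S: "S = s # Cs @ map (\<lambda>i. [i]) [p..<length X]"
    "list_all2 (is_block X) Q Cs" "int (length s) = signed_sum (snd (last T)) T"
    using assms(1) by (rule gp_stateE)
  have len: "length Cs = length Q" using S(2) by (auto dest: list_all2_lengthD)
  then show "length S = Suc (length Q + (length X - p))" by (simp add: S(1))
  assume j: "j < length S"
  show "gp_s S j = (fst (hd T) # map fst Q @ replicate (length X - p) 0) ! j"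
  proof (cases j)
    case 0
    obtain k where "int (length s) = 2 ^ fst (hd T) * (2 * k + 1)"
      using signed_sum_sorted[OF assms(3,2)] S(3) by auto
    then show ?thesis using val2_eq by (auto simp: 0 gp_s_def S(1))
  next
    case (Suc i)
    show ?thesis
    proof (cases "i < length Q")
      case True
      then have "is_block X (Q ! i) (Cs ! i)" using S(2) by (auto simp: list_all2_conv_all_nth)
      then show ?thesis using True len
        by (simp add: Suc gp_s_def S(1) nth_append is_block_def log_nat_power)
    next
      case False
      then show ?thesis using j len
        by (simp add: Suc gp_s_def S(1) nth_append)
    qed
  qed
qed

section \<open>The index chosen by greedy pairing\<close>

lemma nth_rev_sorted:
  assumes "sorted_wrt (<) xs" "Suc j < length xs"
  shows "rev xs ! Suc j < (rev xs ! j :: nat)"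
  using assms by (simp add: rev_nth sorted_wrt_nth_less)

lemma sorted_front:
  assumes "sorted_wrt (<) (map fst (B @ T))" "T \<noteq> []"
  shows "sorted_wrt (<) (map fst (B @ [hd T]))"
  using assms by (cases T) (auto simp: sorted_wrt_append)

lemma gp_cand_none:
  assumes "gp_state X T (rev B) (length X) S" "T \<noteq> []" "sorted_wrt (<) (map fst (B @ T))"
  shows "gp_index S = 0"
proof -
  have sT: "sorted_wrt (<) (map fst T)" using assms(3) by (simp add: sorted_wrt_append)
  let ?xs = "map fst (B @ [hd T])"
  have "\<not> gp_cand S j" for j
  proof
    assume j: "gp_cand S j"
    then have "Suc j < length ?xs"
      using gp_state_levels(1)[OF assms(1,2) sT] by (simp add: gp_cand_def)
    then show False
      using j gp_state_levels(2)[OF assms(1,2) sT, of j] gp_state_levels(2)[OF assms(1,2) sT, of "Suc j"]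
        nth_rev_sorted[OF sorted_front[OF assms(3,2)], of j]
      by (simp add: gp_cand_def rev_map)
  qed
  then show ?thesis by (simp add: gp_index_def)
qed

text \<open>Levels strictly decrease up to the top of the stack, and the pending block
  \<open>u\<close> repeats the level of that top, so the first equality occurs there.\<close>

lemma gp_cand_least:
  assumes "gp_state X T (rev B @ [u]) p S" "T \<noteq> []" "sorted_wrt (<) (map fst (B @ T))"
    and "fst u = fst (hd (B @ T))"
  shows "gp_cand S (length B)" "(LEAST j. gp_cand S j) = length B"
proof -
  have sT: "sorted_wrt (<) (map fst T)" using assms(3) by (simp add: sorted_wrt_append)
  let ?xs = "map fst (B @ [hd T])"
  have len: "length S = Suc (Suc (length B + (length X - p)))"
    using gp_state_levels(1)[OF assms(1,2) sT] by simp
  have lev: "gp_s S j = (rev ?xs @ fst u # replicate (length X - p) 0) ! j" if "j < length S" for j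
    using gp_state_levels(2)[OF assms(1,2) sT that] by (simp add: rev_map)
  have "rev ?xs ! length B = fst u"
    using assms(2,4) by (cases B) (auto simp: nth_append)
  then have "gp_s S (length B) = fst u" using lev[of "length B"] len by (simp only: nth_append) simp
  moreover have "gp_s S (Suc (length B)) = fst u"
    using lev[of "Suc (length B)"] len by (simp add: nth_append)
  ultimately show c: "gp_cand S (length B)" by (simp add: gp_cand_def len)
  show "(LEAST j. gp_cand S j) = length B"
  proof (rule Least_equality)
    show "gp_cand S (length B)" by (rule c)
    fix j assume j: "gp_cand S j"
    show "length B \<le> j"
    proof (rule ccontr)
      assume "\<not> length B \<le> j"
      then have lt: "Suc j < length ?xs" by simp
      then have "gp_s S j = rev ?xs ! j" "gp_s S (Suc j) = rev ?xs ! Suc j"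
        using lev[of j] lev[of "Suc j"] len by (simp_all only: nth_append) simp_all
      then show False
        using j nth_rev_sorted[OF sorted_front[OF assms(3,2)] lt] by (simp add: gp_cand_def)
    qed
  qed
qed

lemma gp_index_pending:
  assumes "gp_state X T (rev B @ [u]) p S" "T \<noteq> []" "sorted_wrt (<) (map fst (B @ T))"
    and "fst u = fst (hd (B @ T))"
  shows "gp_index S = (if signed_sum (snd (last T)) T + int (weight B) \<le> 2 ^ fst u + int (length X - p)
    then length B else 0)"
proof -
  obtain s Cs where S: "S = s # Cs @ map (\<lambda>i. [i]) [p..<length X]"
    "list_all2 (is_block X) (rev B @ [u]) Cs" "int (length s) = signed_sum (snd (last T)) T"
    using assms(1) by (rule gp_stateE)
  obtain Ds c where Cs: "Cs = Ds @ [c]" "list_all2 (is_block X) (rev B) Ds" "is_block X u c"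
    using S(2) by (auto simp: list_all2_append1 list_all2_Cons1)
  have "length Ds = length B" using Cs(2) by (auto dest: list_all2_lengthD)
  then have "take (Suc (length B)) S = s # Ds"
    "drop (Suc (length B)) S = c # map (\<lambda>i. [i]) [p..<length X]"
    by (simp_all add: S(1) Cs(1))
  moreover have "sum_list (map length Ds) = weight B"
    using sum_list_weight_block[OF Cs(2)] by simp
  moreover have "sum_list (map length (map (\<lambda>i. [i]) [p..<length X])) = length X - p"
    by (simp add: o_def sum_list_triv)
  moreover have "length c = 2 ^ fst u" using Cs(3) by (simp add: is_block_def)
  ultimately have "gp_index S = (if 2 ^ fst u + (length X - p) < length s + weight B then 0 else length B)"
    unfolding gp_index_def Let_def Suc_eq_plus1[symmetric]
    using gp_cand_least[OF assms] by auto
  moreover have e: "(2::int) ^ fst u = int (2 ^ fst u)" by simp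
  have "int (length s) + int (weight B) \<le> 2 ^ fst u + int (length X - p) \<longleftrightarrow>
      \<not> 2 ^ fst u + (length X - p) < length s + weight B"
    unfolding e by linarith
  ultimately show ?thesis unfolding S(3)[symmetric] by simp
qed

section \<open>Loop exit and effect of single queries\<close>

lemma gp_loop_leader_large:
  assumes "gp_state X T [] p S" "int (length X - p) < signed_sum (snd (last T)) T"
  shows "gp_loop X f S = 0"
proof -
  obtain s Cs where S: "S = s # Cs @ map (\<lambda>i. [i]) [p..<length X]"
    "list_all2 (is_block X) [] Cs" "int (length s) = signed_sum (snd (last T)) T"
    using assms(1) by (rule gp_stateE)
  have "sum_list (map length (tl S)) = length X - p"
    using S(1,2) by (simp add: o_def sum_list_triv)
  then show ?thesis using S(1,3) assms(2) by (cases f) auto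
qed

text \<open>Taking \<open>b\<close> into the first block adds or removes \<open>2 ^ fst b\<close>
  elements, just as \<open>b\<close> enters the signed sum. Only this sum and the leader's value
  matter, so \<open>T'\<close> may be \<open>b # T\<close> after a reset or the result of a
  \<open>push\<close>.\<close>

lemma combine_gp_first:
  assumes "gp_state X T (b # Q) p S" "2 ^ fst b \<le> signed_sum (snd (last T)) T"
  shows "signed_sum (snd (last T)) (b # T) \<noteq> 0 \<Longrightarrow> snd (last T') = snd (last T) \<Longrightarrow>
      signed_sum (snd (last T)) T' = signed_sum (snd (last T)) (b # T) \<Longrightarrow>
      gp_state X T' Q p (combine_gp X S 0)"
    and "signed_sum (snd (last T)) (b # T) = 0 \<Longrightarrow> Q = [] \<Longrightarrow>
      combine_gp X S 0 = map (\<lambda>i. [i]) [p..<length X]"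
proof -
  let ?v = "snd (last T)"
  obtain s Cs where S: "S = s # Cs @ map (\<lambda>i. [i]) [p..<length X]"
    "list_all2 (is_block X) (b # Q) Cs" "\<forall>a\<in>set s. X ! a = ?v" "int (length s) = signed_sum ?v T"
    using assms(1) by (rule gp_stateE)
  obtain c Ds where Cs: "Cs = c # Ds" "is_block X b c" "list_all2 (is_block X) Q Ds"
    using S(2) by (auto simp: list_all2_Cons1)
  have c: "length c = 2 ^ fst b" "\<forall>a\<in>set c. X ! a = snd b" "c \<noteq> []"
    using Cs(2) is_block_nonempty by (auto simp: is_block_def)
  have ic: "int (length c) = 2 ^ fst b" by (simp add: c(1))
  then have le: "length c \<le> length s" using assms(2) S(4) by linarith
  then have "s \<noteq> []" using c(3) by auto
  then have q: "query X s c \<longleftrightarrow> snd b \<noteq> ?v"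
    using S(3) c(2,3) by (auto simp: query_def)
  have comb: "combine_gp X S 0 = (if snd b = ?v then [s @ c]
      else if length c < length s then [drop (length c) s] else []) @ Ds @ map (\<lambda>i. [i]) [p..<length X]"
    using q by (simp add: combine_gp_def S(1) Cs(1))
  { assume "signed_sum ?v (b # T) \<noteq> 0" and T': "snd (last T') = ?v" "signed_sum ?v T' = signed_sum ?v (b # T)"
    have nz: "snd b = ?v \<or> length c \<noteq> length s"
    proof (rule ccontr)
      assume neg: "\<not> (snd b = ?v \<or> length c \<noteq> length s)"
      then have "signed_sum ?v (b # T) = int (length s) - int (length c)" unfolding ic S(4) by simp
      then show False using neg \<open>signed_sum ?v (b # T) \<noteq> 0\<close> by simp
    qed
    define s' where "s' = (if snd b = ?v then s @ c else drop (length c) s)"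
    have "combine_gp X S 0 = s' # Ds @ map (\<lambda>i. [i]) [p..<length X]"
      using nz le by (auto simp: comb s'_def)
    moreover have "\<forall>a\<in>set s'. X ! a = ?v"
      using S(3) c(2) by (auto simp: s'_def dest: in_set_dropD)
    moreover have "int (length s') = signed_sum ?v (b # T)"
      using le ic S(4) by (auto simp: s'_def)
    ultimately show "gp_state X T' Q p (combine_gp X S 0)"
      using Cs(3) unfolding gp_state_def T' by blast }
  { assume z: "signed_sum ?v (b # T) = 0" and "Q = []"
    then have "Ds = []" using Cs(3) by simp
    moreover have "snd b \<noteq> ?v"
    proof
      assume "snd b = ?v"
      then have "int (length c) + int (length s) = 0" using z ic S(4) by simp
      then have "length c = 0" by linarith
      then show False using c(3) by simp
    qed
    moreover have "length c = length s" using z ic S(4) \<open>snd b \<noteq> ?v\<close> by simp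
    ultimately show "combine_gp X S 0 = map (\<lambda>i. [i]) [p..<length X]" by (simp add: comb) }
qed

lemma combine_gp_last:
  assumes "gp_state X T (Q @ [(l, w), (l, x)]) p S"
  shows "gp_state X T (if w = x then Q @ [(Suc l, x)] else Q) p (combine_gp X S (Suc (length Q)))"
proof -
  obtain s Cs where S: "S = s # Cs @ map (\<lambda>i. [i]) [p..<length X]"
    "list_all2 (is_block X) (Q @ [(l, w), (l, x)]) Cs" "\<forall>a\<in>set s. X ! a = snd (last T)"
    "int (length s) = signed_sum (snd (last T)) T"
    using assms(1) by (rule gp_stateE)
  obtain Ds c d where Cs: "Cs = Ds @ [c, d]" "list_all2 (is_block X) Q Ds"
    "is_block X (l, w) c" "is_block X (l, x) d"
    using S(2) by (auto simp: list_all2_append1 list_all2_Cons1)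
  have len: "length Ds = length Q" using Cs(2) by (auto dest: list_all2_lengthD)
  have q: "query X c d \<longleftrightarrow> w \<noteq> x" using is_block_query[OF Cs(3,4)] by simp
  have eq: "length c = length d" using Cs(3,4) by (simp add: is_block_def)
  have comb: "combine_gp X S (Suc (length Q)) =
      s # (Ds @ (if w = x then [c @ d] else [])) @ map (\<lambda>i. [i]) [p..<length X]"
    using q eq by (simp add: combine_gp_def S(1) Cs(1) nth_append len[symmetric])
  moreover have "list_all2 (is_block X) (if w = x then Q @ [(Suc l, x)] else Q)
      (Ds @ (if w = x then [c @ d] else []))"
    using Cs(2-4) is_block_append by (auto intro!: list_all2_appendI)
  ultimately show ?thesis using S(3,4) unfolding gp_state_def by blast
qed

subsection \<open>Simulation of the stack machine\<close>

text \<open>The unread bits are \<open>ys @ zs\<close>, where only \<open>ys\<close> belongs to the prefix on which oblivious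
pairing runs. If \<open>zs\<close> is nonempty, the sums condition forbids greedy pairing to use it.\<close>

definition unread_ok :: "bool list \<Rightarrow> nat \<Rightarrow> (nat \<times> bool) list \<Rightarrow> bool list \<Rightarrow> bool list \<Rightarrow> bool" where
  "unread_ok X p st ys zs \<longleftrightarrow> p \<le> length X \<and> drop p X = ys @ zs \<and> weight st \<le> p
     \<and> (zs = [] \<or> int (length zs) < \<bar>signed_sum True st + signed_sum True (map (Pair 0) ys)\<bar>)"

text \<open>A reset that extends \<open>T\<close> establishes these two bounds; they let a
  cancellation inside \<open>T\<close> be paid from the budget.\<close>

definition merged_ok :: "(nat \<times> bool) list \<Rightarrow> (nat \<times> bool) list \<Rightarrow> nat \<Rightarrow> bool" where
  "merged_ok T st n \<longleftrightarrow>
     (2 \<le> length T \<longrightarrow> critical T n \<and> slack (snd (last T)) st n < 4 * 2 ^ fst (hd T))"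

text \<open>The stack is \<open>B @ T\<close>: greedy pairing has one block for \<open>T\<close>, one for each member of \<open>B\<close>,
and singletons for the positions from \<open>p\<close> on. In a pending state a further block \<open>(l, x)\<close> is about
to be combined with the top of the stack.\<close>

definition normal where
  "normal X T B p ys zs S \<longleftrightarrow> T \<noteq> [] \<and> sorted_wrt (<) (map fst (B @ T)) \<and> gp_state X T (rev B) p S
     \<and> unread_ok X p (B @ T) ys zs \<and> merged_ok T (B @ T) (length X - p)"

definition pending where
  "pending X T B l x p ys zs S \<longleftrightarrow> T \<noteq> [] \<and> sorted_wrt (<) (map fst (B @ T))
     \<and> gp_state X T (rev B @ [(l, x)]) p S
     \<and> unread_ok X p ((l, x) # B @ T) ys zs \<and> merged_ok T ((l, x) # B @ T) (length X - p)
     \<and> fst (hd (B @ T)) = l \<and> - 2 \<le> slack (snd (last T)) ((l, x) # B @ T) (length X - p)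
     \<and> signed_sum (snd (last T)) T + int (weight B) \<le> 2 ^ l + int (length X - p)"

definition normal_bound where
  "normal_bound L X f \<longleftrightarrow> (\<forall>T B p ys zs S. normal X T B p ys zs S \<longrightarrow>
     gp_loop X f S \<le> run_cost 0 (B @ T) ys + potential L T (B @ T) (length X - p))"

definition pending_bound where
  "pending_bound L X f \<longleftrightarrow> (\<forall>T B l x p ys zs S. pending X T B l x p ys zs S \<longrightarrow>
     gp_loop X f S \<le> push_cost l x (B @ T) + run_cost 0 (push l x (B @ T)) ys
       + potential L T ((l, x) # B @ T) (length X - p))"

section \<open>Levels and unread bits\<close>

lemma level_le:
  assumes "weight st \<le> N" "N < 2 ^ Suc L" "b \<in> set st"
  shows "fst b \<le> L"
proof -
  have "2 ^ fst b \<le> weight st"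
    using assms(3) by (auto simp: weight_def intro!: member_le_sum_list)
  then have "(2::nat) ^ fst b < 2 ^ Suc L" using assms(1,2) by linarith
  then show ?thesis by (simp only: power_strict_increasing_iff one_less_numeral_iff semiring_norm less_Suc_eq_le)
qed

lemma length_sorted_le:
  assumes "sorted_wrt (<) (map fst st)" "\<forall>b\<in>set st. fst b \<le> L"
  shows "length st \<le> Suc L"
proof -
  have "distinct (map fst st)" using assms(1) by (simp add: strict_sorted_iff)
  then have "length st = card (fst ` set st)" using distinct_card[of "map fst st"] by simp
  also have "\<dots> \<le> card {..L}" by (rule card_mono) (use assms(2) in auto)
  finally show ?thesis by simp
qed

lemma unread_ok_weight:
  assumes "unread_ok X p st ys zs" "length X < 2 ^ Suc L"
  shows "\<forall>b\<in>set st. fst b \<le> L"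
  using assms level_le[of st "length X" L] by (auto simp: unread_ok_def)

lemma unread_ok_cong:
  assumes "unread_ok X p st ys zs" "weight st' \<le> weight st" "signed_sum True st' = signed_sum True st"
  shows "unread_ok X p st' ys zs"
  using assms by (auto simp: unread_ok_def)

text \<open>Once \<open>ys\<close> is exhausted, the bit comes from \<open>zs\<close>, whose length
  drops by one while the signed sum changes by one, so the strict inequality survives.\<close>

lemma unread_ok_read:
  assumes "unread_ok X p st ys zs" "p < length X"
  obtains ys' zs' where "unread_ok X (Suc p) ((0, X ! p) # st) ys' zs'"
    "ys = X ! p # ys' \<or> (ys = [] \<and> ys' = [])"
proof -
  have d: "X ! p # drop (Suc p) X = ys @ zs"
    using assms by (simp add: unread_ok_def Cons_nth_drop_Suc)
  show ?thesis
  proof (cases ys)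
    case Nil
    then obtain zs' where zs: "zs = X ! p # zs'" "drop (Suc p) X = zs'" using d by auto
    have "int (length zs') < \<bar>signed_sum True ((0, X ! p) # st)\<bar>"
      using assms(1) Nil zs(1) by (auto simp: unread_ok_def)
    then have "unread_ok X (Suc p) ((0, X ! p) # st) [] zs'"
      using assms zs by (auto simp: unread_ok_def)
    then show ?thesis using that Nil by blast
  next
    case (Cons y ys')
    then have "y = X ! p" "drop (Suc p) X = ys' @ zs" using d by auto
    then have "unread_ok X (Suc p) ((0, X ! p) # st) ys' zs"
      using assms Cons by (auto simp: unread_ok_def algebra_simps)
    then show ?thesis using that Cons \<open>y = X ! p\<close> by blast
  qed
qed

text \<open>Without a first block the next bit becomes the leader at no cost. This covers both the
  start of the algorithm and the state after a leader is cancelled.\<close>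

lemma empty_bound:
  assumes "normal_bound L X f" "unread_ok X p [] ys zs"
  shows "gp_loop X f (map (\<lambda>i. [i]) [p..<length X]) \<le> run_cost 0 [] ys + potential L [] [] (length X - p)"
proof (cases "p < length X")
  case False
  then show ?thesis by (cases f) auto
next
  case True
  from assms(2) True obtain ys' zs' where u: "unread_ok X (Suc p) [(0, X ! p)] ys' zs'"
    and ys: "ys = X ! p # ys' \<or> (ys = [] \<and> ys' = [])" by (rule unread_ok_read)
  have "gp_state X [(0, X ! p)] [] (Suc p) (map (\<lambda>i. [i]) [p..<length X])"
    using True by (auto simp: gp_state_def upt_conv_Cons)
  then have "normal X [(0, X ! p)] [] (Suc p) ys' zs' (map (\<lambda>i. [i]) [p..<length X])"
    using u by (simp add: normal_def merged_ok_def)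
  then have "gp_loop X f (map (\<lambda>i. [i]) [p..<length X])
      \<le> run_cost 0 [(0, X ! p)] ys' + potential L [(0, X ! p)] [(0, X ! p)] (length X - Suc p)"
    using assms(1) unfolding normal_bound_def by fastforce
  moreover have "run_cost 0 [(0, X ! p)] ys' = run_cost 0 [] ys" using ys by auto
  moreover have "cancel_budget L [(0, X ! p)] (length X - Suc p) \<le> cancel_budget L [] (length X - p)"
    using cancel_budget_read[of L "X ! p" "[]" "length X - Suc p"] True by (simp add: Suc_diff_Suc)
  ultimately show ?thesis by (simp add: potential_def)
qed

section \<open>Steps of the simulation\<close>

lemma push_length: "length (push l v st) \<le> Suc (length st)"
  by (induction l v st rule: push.induct) auto

lemma critical_mono:
  "critical T n \<Longrightarrow> T' \<noteq> [] \<Longrightarrow> fst (last T) \<le> fst (last T') \<Longrightarrow> critical T' n"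
proof -
  assume a: "critical T n" "T' \<noteq> []" "fst (last T) \<le> fst (last T')"
  have "(2::nat) ^ fst (last T) \<le> 2 ^ fst (last T')" using a(3) by (rule power_increasing) simp
  moreover have "n < 2 * 2 ^ fst (last T)" using a(1) by (simp add: critical_def)
  ultimately have "n < 2 * 2 ^ fst (last T')" by linarith
  then show ?thesis using a(2) by (simp add: critical_def)
qed

text \<open>The sums condition rules out a reset. If \<open>B\<close> is empty, one query takes the
  pending block into the first block and thereby performs the whole chain of \<open>push\<close>
  inside \<open>T\<close>. Otherwise the query is one that the stack machine makes too, and the new
  state is pending or normal.\<close>

lemma pending_step:
  assumes N: "length X < 2 ^ Suc L" and nb: "normal_bound L X f" and pb: "pending_bound L X f"
  shows "pending_bound L X (Suc f)"
  unfolding pending_bound_def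
proof (intro allI impI)
  fix T B l x p ys zs S
  assume pend: "pending X T B l x p ys zs S"
  let ?n = "length X - p" and ?v = "snd (last T)"
  note P = pend[unfolded pending_def]
  have ne: "T \<noteq> []" and sorted: "sorted_wrt (<) (map fst (B @ T))"
    and gp: "gp_state X T (rev B @ [(l, x)]) p S"
    and un: "unread_ok X p ((l, x) # B @ T) ys zs"
    and mo: "merged_ok T ((l, x) # B @ T) ?n"
    and top: "fst (hd (B @ T)) = l" and lo: "- 2 \<le> slack ?v ((l, x) # B @ T) ?n"
    and chk: "signed_sum ?v T + int (weight B) \<le> 2 ^ l + int ?n"
    using P by auto
  have sT: "sorted_wrt (<) (map fst T)" using sorted by (simp add: sorted_wrt_append)
  have lev: "\<forall>b\<in>set ((l, x) # B @ T). fst b \<le> L" by (rule unread_ok_weight[OF un N])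
  have idx: "gp_index S = length B"
    using gp_index_pending[OF gp ne sorted] top chk by simp
  have loop: "gp_loop X (Suc f) S \<le> Suc (gp_loop X f (combine_gp X S (length B)))"
    by (simp add: idx)
  show "gp_loop X (Suc f) S \<le> push_cost l x (B @ T) + run_cost 0 (push l x (B @ T)) ys
       + potential L T ((l, x) # B @ T) ?n"
  proof (cases B)
    case Nil
    let ?T = "push l x T"
    have tl: "fst (hd T) = l" using top Nil by simp
    have above: "\<forall>b\<in>set T. l \<le> fst b" using sT ne tl by (cases T) auto
    have sorted': "sorted_wrt (<) (map fst ?T)" "\<forall>b\<in>set ?T. l \<le> fst b"
      using push_sorted[OF sT above] by auto
    have ge: "2 ^ fst (l, x) \<le> signed_sum ?v T" using signed_sum_sorted[OF sT ne] tl by simp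
    have gp': "gp_state X T ((l, x) # []) p S" using gp Nil by simp
    have un': "unread_ok X p ?T ys zs"
      using un Nil push_weight[of l x T] push_signed_sum[of True l x T]
      by (intro unread_ok_cong[OF un]) auto
    have pot: "Suc (potential L ?T ?T ?n) \<le> push_cost l x T + potential L T ((l, x) # T) ?n"
    proof (rule push_potential[OF ne sT tl])
      show "length T \<le> Suc L" using length_sorted_le[OF sT] lev by simp
    qed (use lev lo mo Nil tl in \<open>auto simp: merged_ok_def\<close>)
    have "gp_loop X f (combine_gp X S 0) \<le> run_cost 0 ?T ys + potential L ?T ?T ?n"
    proof (cases "?T = []")
      case True
      then have "signed_sum ?v ((l, x) # T) = 0" using push_signed_sum[of ?v l x T] by simp
      then have "combine_gp X S 0 = map (\<lambda>i. [i]) [p..<length X]"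
        using combine_gp_first(2)[OF gp' ge] by simp
      then show ?thesis using empty_bound[OF nb] un' True by simp
    next
      case False
      have lst: "snd (last ?T) = ?v" "fst (last T) \<le> fst (last ?T)"
        using push_last[OF ne False] by auto
      \<comment> \<open>Distinct levels make the signed sum of a nonempty stack positive, so the
        first block survives just as the stack does.\<close>
      have "signed_sum ?v ?T > 0"
        using signed_sum_sorted[OF sorted'(1) False] lst(1)
        by (intro less_le_trans[OF _ signed_sum_sorted[OF sorted'(1) False, unfolded lst(1), THEN conjunct1]]) simp
      then have nz: "signed_sum ?v ((l, x) # T) \<noteq> 0" using push_signed_sum[of ?v l x T] by simp
      have "gp_state X ?T [] p (combine_gp X S 0)"
        by (rule combine_gp_first(1)[OF gp' ge nz lst(1) push_signed_sum])
      moreover have "merged_ok ?T ?T ?n"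
        unfolding merged_ok_def
      proof
        assume "2 \<le> length ?T"
        \<comment> \<open>A push that meets an equal level adds no block, so \<open>T\<close> was
          already long enough for the bounds in \<open>mo\<close>.\<close>
        moreover have "length ?T \<le> length T"
          using ne tl push_length[of "Suc l" x "tl T"] by (cases T) (auto split: if_splits)
        ultimately have m: "critical T ?n" "slack ?v ((l, x) # T) ?n < 4 * 2 ^ l"
          using mo Nil tl by (auto simp: merged_ok_def)
        have "(2::int) ^ l \<le> 2 ^ fst (hd ?T)"
          by (rule power_increasing) (use sorted'(2) False in auto)
        moreover have "slack (snd (last ?T)) ?T ?n = slack ?v ((l, x) # T) ?n"
          by (simp only: slack_def lst(1) push_signed_sum)
        ultimately have "slack (snd (last ?T)) ?T ?n < 4 * 2 ^ fst (hd ?T)"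
          using m(2) by linarith
        then show "critical ?T ?n \<and> slack (snd (last ?T)) ?T ?n < 4 * 2 ^ fst (hd ?T)"
          using critical_mono[OF m(1) False lst(2)] by blast
      qed
      ultimately have "normal X ?T [] p ys zs (combine_gp X S 0)"
        using False sorted'(1) un' by (simp add: normal_def)
      then show ?thesis using nb unfolding normal_bound_def by fastforce
    qed
    then show ?thesis using loop pot Nil by simp
  next
    case (Cons b B')
    then obtain w where b: "b = (l, w)" using top by (cases b) auto
    have gp': "gp_state X T (rev B' @ [(l, w), (l, x)]) p S" using gp Cons b by simp
    define S' where "S' = combine_gp X S (length B)"
    have S': "gp_state X T (if w = x then rev B' @ [(Suc l, x)] else rev B') p S'"
      using combine_gp_last[OF gp'] Cons by (simp add: S'_def)
    have sorted': "sorted_wrt (<) (map fst (B' @ T))" "\<forall>c\<in>set (B' @ T). l < fst c"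
      using sorted Cons b by auto
    show ?thesis
    proof (cases "w = x")
      case True
      have sums: "signed_sum u ((Suc l, x) # B' @ T) = signed_sum u ((l, x) # B @ T)"
        "weight ((Suc l, x) # B' @ T) = weight ((l, x) # B @ T)" for u
        using True Cons b by auto
      have un': "unread_ok X p ((Suc l, x) # B' @ T) ys zs"
        by (rule unread_ok_cong[OF un eq_refl[OF sums(2)] sums(1)])
      have mo': "merged_ok T ((Suc l, x) # B' @ T) ?n" using mo sums(1)[of ?v] by (simp only: merged_ok_def slack_def)
      have psi: "cancel_budget L ((Suc l, x) # B' @ T) ?n \<le> cancel_budget L ((l, x) # B @ T) ?n"
        using cancel_budget_merge[of L l x "B' @ T" ?n] True Cons b by simp
      have push: "push l x (B @ T) = push (Suc l) x (B' @ T)"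
        "push_cost l x (B @ T) = Suc (push_cost (Suc l) x (B' @ T))"
        using True Cons b by auto
      show ?thesis
      proof (cases "fst (hd (B' @ T)) = Suc l")
        case step: True
        have "(0::int) \<le> 2 * 2 ^ l" by simp
        \<comment> \<open>The block \<open>b\<close> moves from the left to the right side of the
          reset test, so no reset interrupts a chain of merges.\<close>
        moreover have "signed_sum ?v T + int (weight B') \<le> int ?n" using chk Cons b by simp
        ultimately have "signed_sum ?v T + int (weight B') \<le> 2 ^ Suc l + int ?n"
          unfolding power_Suc by linarith
        then have "pending X T B' (Suc l) x p ys zs S'"
          unfolding pending_def
          using ne sorted'(1) S' True un' mo' step lo sums(1)[of ?v]
          by (auto simp: slack_def simp del: signed_sum_simps)
        then have "gp_loop X f S' \<le> push_cost (Suc l) x (B' @ T) + run_cost 0 (push (Suc l) x (B' @ T)) ys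
            + potential L T ((Suc l, x) # B' @ T) ?n"
          using pb unfolding pending_bound_def by blast
        then show ?thesis using loop psi push by (simp add: S'_def potential_def)
      next
        case False
        have free: "\<forall>c\<in>set (B' @ T). Suc l < fst c"
        proof -
          obtain c C where C: "B' @ T = c # C" using ne by (cases "B' @ T") auto
          have "Suc l < fst c" using sorted'(2) False unfolding C by (simp add: Suc_lessI)
          then show ?thesis using sorted'(1) unfolding C by fastforce
        qed
        have "normal X T ((Suc l, x) # B') p ys zs S'"
          unfolding normal_def using ne sorted'(1) S' True un' mo' free by auto
        then have "gp_loop X f S' \<le> run_cost 0 (((Suc l, x) # B') @ T) ys
            + potential L T (((Suc l, x) # B') @ T) ?n"
          using nb unfolding normal_bound_def by blast
        then show ?thesis using loop psi push push_free[OF free, of x] by (simp add: S'_def potential_def)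
      qed
    next
      case False
      have sums: "signed_sum u (B' @ T) = signed_sum u ((l, x) # B @ T)"
        "weight (B' @ T) \<le> weight ((l, x) # B @ T)" for u
        using False Cons b by auto
      have un': "unread_ok X p (B' @ T) ys zs"
        by (rule unread_ok_cong[OF un sums(2) sums(1)])
      have mo': "merged_ok T (B' @ T) ?n" using mo sums(1)[of ?v] by (simp only: merged_ok_def slack_def)
      have psi: "cancel_budget L (B' @ T) ?n \<le> cancel_budget L ((l, x) # B @ T) ?n"
        using cancel_budget_cancel[of "B' @ T" x w L ?n l] False Cons b ne by simp
      have push: "push l x (B @ T) = B' @ T" "push_cost l x (B @ T) = 1"
        using False Cons b by auto
      have "normal X T B' p ys zs S'"
        unfolding normal_def using ne sorted'(1) S' False un' mo' by auto
      then have "gp_loop X f S' \<le> run_cost 0 (B' @ T) ys + potential L T (B' @ T) ?n"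
        using nb unfolding normal_bound_def by blast
      then show ?thesis using loop psi push by (simp add: S'_def potential_def)
    qed
  qed
qed

text \<open>When the reset test fires, either \<open>B\<close> is empty and the loop ends, or the
  oldest block \<open>b\<close> of \<open>B\<close> joins \<open>T\<close>, whose growth pays for
  the query. The hypothesis \<open>large\<close> makes the leader critical and gives
  \<open>slack < 2 * weight B < 4 * 2 ^ fst b\<close>.\<close>

lemma merge_leader_step:
  assumes N: "length X < 2 ^ Suc L" and nb: "normal_bound L X f"
    and nor: "normal X T B p ys zs S"
    and top: "p < length X \<Longrightarrow> fst (hd (B @ T)) = 0"
    and large: "int (length X - p) < signed_sum (snd (last T)) T + int (weight B)"
  shows "gp_loop X (Suc f) S \<le> run_cost 0 (B @ T) ys + potential L T (B @ T) (length X - p)"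
proof -
  let ?n = "length X - p" and ?v = "snd (last T)"
  have ne: "T \<noteq> []" and sorted: "sorted_wrt (<) (map fst (B @ T))"
    and gp: "gp_state X T (rev B) p S" and un: "unread_ok X p (B @ T) ys zs"
    using nor by (auto simp: normal_def)
  have sT: "sorted_wrt (<) (map fst T)" and sB: "sorted_wrt (<) (map fst B)"
    using sorted by (auto simp: sorted_wrt_append)
  show ?thesis
  proof (cases B rule: rev_cases)
    case Nil
    then show ?thesis using gp_loop_leader_large[of X T p S "Suc f"] gp large by simp
  next
    case (snoc B' b)
    have idx: "gp_index S = 0"
    proof (cases "p < length X")
      case True
      \<comment> \<open>The next singleton plays the pending block; together with the bits after it,
        it weighs \<open>length X - p\<close>.\<close>
      have "gp_state X T (rev B @ [(0, X ! p)]) (Suc p) S" by (rule gp_state_read[OF gp True])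
      from gp_index_pending[OF this ne sorted] show ?thesis using top[OF True] large True by auto
    next
      case False
      then have "p = length X" using un by (simp add: unread_ok_def)
      then show ?thesis using gp_cand_none[OF _ ne sorted] gp by simp
    qed
    define S' where "S' = combine_gp X S 0"
    have sorted': "sorted_wrt (<) (map fst (b # T))" using sorted snoc by (auto simp: sorted_wrt_append)
    have pos: "2 ^ fst (hd T) \<le> signed_sum ?v T" using signed_sum_sorted[OF sT ne] by simp
    have "fst b < fst (hd T)" using sorted' ne by auto
    then have "(2::int) ^ fst b \<le> 2 ^ fst (hd T)" by (intro power_increasing) auto
    then have ge: "2 ^ fst b \<le> signed_sum ?v T" using pos by linarith
    have "2 ^ fst b \<le> signed_sum ?v (b # T)" using signed_sum_sorted[OF sorted'] ne by simp
    moreover have "(0::int) < 2 ^ fst b" by simp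
    ultimately have nz: "signed_sum ?v (b # T) \<noteq> 0" by linarith
    have gp': "gp_state X (b # T) (rev B') p S'"
      unfolding S'_def
      by (rule combine_gp_first(1)[OF _ ge nz]) (use gp snoc ne in auto)
    have "merged_ok (b # T) (B @ T) ?n"
      unfolding merged_ok_def
    proof
      have "signed_sum ?v T + int (weight B) \<le> int (weight (B @ T))"
        using abs_signed_sum_le[of ?v T] by simp
      then have "?n < weight (B @ T)" using large by linarith
      also have "\<dots> < 2 * 2 ^ fst (last (B @ T))" using weight_sorted[OF sorted] ne by simp
      finally have crit: "critical (b # T) ?n" using ne by (simp add: critical_def)
      have "- int (weight B) \<le> signed_sum ?v B" using abs_signed_sum_le[of ?v B] by linarith
      then have "slack ?v (B @ T) ?n < 2 * int (weight B)"
        using large unfolding slack_def signed_sum_simps by linarith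
      also have "weight B < 2 * 2 ^ fst b" using weight_sorted[OF sB] snoc by simp
      then have "2 * int (weight B) < 2 * int (2 * 2 ^ fst b)" by linarith
      finally show "critical (b # T) ?n \<and> slack (snd (last (b # T))) (B @ T) ?n < 4 * 2 ^ fst (hd (b # T))"
        using crit ne by simp
    qed
    then have "normal X (b # T) B' p ys zs S'"
      using sorted un gp' snoc by (simp add: normal_def)
    then have "gp_loop X f S' \<le> run_cost 0 (B' @ b # T) ys + potential L (b # T) (B' @ b # T) ?n"
      using nb unfolding normal_bound_def by blast
    moreover have "length (b # T) \<le> Suc L"
      using length_sorted_le[OF sorted'] unread_ok_weight[OF un N] snoc by auto
    then have "Suc (potential L (b # T) (B' @ b # T) ?n) = potential L T (B @ T) ?n"
      using ne snoc by (cases T) (auto simp: potential_def)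
    moreover have "gp_loop X (Suc f) S \<le> Suc (gp_loop X f S')" by (simp add: idx S'_def)
    ultimately show ?thesis using snoc by simp
  qed
qed

lemma normal_step_top:
  assumes N: "length X < 2 ^ Suc L" and nb: "normal_bound L X f" and pb: "pending_bound L X (Suc f)"
    and nor: "normal X T B p ys zs S"
    and top: "p < length X \<Longrightarrow> fst (hd (B @ T)) = 0"
  shows "gp_loop X (Suc f) S \<le> run_cost 0 (B @ T) ys + potential L T (B @ T) (length X - p)"
proof (cases "int (length X - p) < signed_sum (snd (last T)) T + int (weight B)")
  case True
  then show ?thesis using merge_leader_step[OF N nb nor top] by blast
next
  case False
  let ?v = "snd (last T)"
  have ne: "T \<noteq> []" and sorted: "sorted_wrt (<) (map fst (B @ T))"
    and gp: "gp_state X T (rev B) p S" and un: "unread_ok X p (B @ T) ys zs"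
    and mo: "merged_ok T (B @ T) (length X - p)"
    using nor by (auto simp: normal_def)
  have sT: "sorted_wrt (<) (map fst T)" using sorted by (auto simp: sorted_wrt_append)
  have "(0::int) < 2 ^ fst (hd T)" by simp
  then have "0 < signed_sum ?v T" using signed_sum_sorted[OF sT ne] by linarith
  then have p: "p < length X" using False by linarith
  then have n: "length X - p = Suc (length X - Suc p)" by simp
  obtain ys' zs' where un': "unread_ok X (Suc p) ((0, X ! p) # B @ T) ys' zs'"
    and ys: "ys = X ! p # ys' \<or> (ys = [] \<and> ys' = [])"
    using unread_ok_read[OF un p] by blast
  \<comment> \<open>Beyond the prefix the signed weight of the stack exceeds the number of unread
    bits, so a reset would be due there.\<close>
  have "ys \<noteq> []"
  proof
    assume "ys = []"
    then have zs: "length zs = length X - p" "zs \<noteq> []"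
      using un p by (auto simp: unread_ok_def dest: arg_cong[of _ _ length])
    then have "int (length X - p) < \<bar>signed_sum True (B @ T)\<bar>"
      using un \<open>ys = []\<close> by (auto simp: unread_ok_def)
    also have "\<dots> = \<bar>signed_sum ?v (B @ T)\<bar>" by (rule abs_signed_sum_eq)
    also have "\<dots> \<le> signed_sum ?v T + int (weight B)"
      using \<open>0 < signed_sum ?v T\<close> abs_signed_sum_le[of ?v B] unfolding signed_sum_simps by linarith
    finally show False using False by simp
  qed
  then have ys: "ys = X ! p # ys'" using ys by simp
  let ?u = "(0, X ! p)"
  have sl: "slack ?v (?u # B @ T) (length X - Suc p) \<le> slack ?v (B @ T) (length X - p)"
    "slack ?v (B @ T) (length X - p) - 2 \<le> slack ?v (?u # B @ T) (length X - Suc p)"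
    using n by (auto simp: slack_def)
  have "pending X T B 0 (X ! p) (Suc p) ys' zs' S"
    unfolding pending_def
  proof (intro conjI)
    show "merged_ok T (?u # B @ T) (length X - Suc p)"
      using mo sl(1) n by (auto simp: merged_ok_def critical_def)
    \<comment> \<open>Since no reset is due, the slack is nonnegative before the read, and the read
      lowers it by at most 2.\<close>
    have "signed_sum ?v B \<le> int (weight B)" using abs_signed_sum_le[of ?v B] by linarith
    then have "0 \<le> slack ?v (B @ T) (length X - p)"
      using False unfolding slack_def signed_sum_simps by linarith
    then show "- 2 \<le> slack ?v (?u # B @ T) (length X - Suc p)" using sl(2) by linarith
    show "signed_sum ?v T + int (weight B) \<le> 2 ^ 0 + int (length X - Suc p)" using False n by simp
  qed (use ne sorted gp_state_read[OF gp p] un' top[OF p] in auto)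
  then have "gp_loop X (Suc f) S \<le> push_cost 0 (X ! p) (B @ T) + run_cost 0 (push 0 (X ! p) (B @ T)) ys'
       + potential L T (?u # B @ T) (length X - Suc p)"
    using pb unfolding pending_bound_def by blast
  moreover have "potential L T (?u # B @ T) (length X - Suc p) \<le> potential L T (B @ T) (length X - p)"
    using cancel_budget_read[of L "X ! p" "B @ T" "length X - Suc p"] n by (simp add: potential_def)
  ultimately show ?thesis by (simp add: ys)
qed

text \<open>If the top has positive level, the next bit is first read as a block of level 0. This
  makes no query, so the fuel stays the same and \<open>normal_step_top\<close> applies.\<close>

lemma normal_step:
  assumes N: "length X < 2 ^ Suc L" and nb: "normal_bound L X f" and pb: "pending_bound L X (Suc f)"
  shows "normal_bound L X (Suc f)"
  unfolding normal_bound_def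
proof (intro allI impI)
  fix T B p ys zs S
  assume nor: "normal X T B p ys zs S"
  show "gp_loop X (Suc f) S \<le> run_cost 0 (B @ T) ys + potential L T (B @ T) (length X - p)"
  proof (cases "p < length X \<longrightarrow> fst (hd (B @ T)) = 0")
    case True
    then show ?thesis using normal_step_top[OF N nb pb nor] by blast
  next
    case False
    then have p: "p < length X" and nz: "fst (hd (B @ T)) \<noteq> 0" by auto
    have ne: "T \<noteq> []" and sorted: "sorted_wrt (<) (map fst (B @ T))"
      and gp: "gp_state X T (rev B) p S" and un: "unread_ok X p (B @ T) ys zs"
      and mo: "merged_ok T (B @ T) (length X - p)"
      using nor by (auto simp: normal_def)
    have n: "length X - p = Suc (length X - Suc p)" using p by simp
    obtain ys' zs' where un': "unread_ok X (Suc p) ((0, X ! p) # B @ T) ys' zs'"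
      and ys: "ys = X ! p # ys' \<or> (ys = [] \<and> ys' = [])"
      using unread_ok_read[OF un p] by blast
    let ?u = "(0, X ! p)"
    have free: "\<forall>c\<in>set (B @ T). 0 < fst c"
    proof -
      obtain c C where C: "B @ T = c # C" using ne by (cases "B @ T") auto
      show ?thesis using sorted nz unfolding C by auto
    qed
    have "slack (snd (last T)) (?u # B @ T) (length X - Suc p) \<le> slack (snd (last T)) (B @ T) (length X - p)"
      using n by (auto simp: slack_def)
    then have "merged_ok T (?u # B @ T) (length X - Suc p)"
      using mo n by (auto simp: merged_ok_def critical_def)
    then have "normal X T (?u # B) (Suc p) ys' zs' S"
      using ne sorted free gp_state_read[OF gp p] un' by (auto simp: normal_def)
    then have "gp_loop X (Suc f) S \<le> run_cost 0 ((?u # B) @ T) ys' + potential L T ((?u # B) @ T) (length X - Suc p)"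
      by (rule normal_step_top[OF N nb pb]) simp
    moreover have "run_cost 0 ((?u # B) @ T) ys' = run_cost 0 (B @ T) ys"
      using ys push_free[OF free, of "X ! p"] by auto
    moreover have "potential L T ((?u # B) @ T) (length X - Suc p) \<le> potential L T (B @ T) (length X - p)"
      using cancel_budget_read[of L "X ! p" "B @ T" "length X - Suc p"] n by (simp add: potential_def)
    ultimately show ?thesis by linarith
  qed
qed

text \<open>For each fuel the pending bound comes first, since a normal state turns pending by
  reading, which spends no fuel.\<close>

lemma gp_bounds:
  assumes "length X < 2 ^ Suc L"
  shows "normal_bound L X f \<and> pending_bound L X f"
proof (induction f)
  case 0
  show ?case by (simp add: normal_bound_def pending_bound_def)
next
  case (Suc f)
  then show ?case using pending_step[OF assms] normal_step[OF assms] by blast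
qed

section \<open>The prefix and its majority count\<close>

lemma signed_sum_count:
  "signed_sum v (map (Pair 0) ys) = int (count_list ys v) - int (count_list ys (\<not> v))"
  by (induction ys) auto

lemma count_list_length: "count_list xs v + count_list xs (\<not> v) = length (xs :: bool list)"
  by (induction xs) auto

text \<open>Prefix counts grow by at most one per bit, so they skip no value.\<close>

lemma count_list_take_ex:
  assumes "k \<le> count_list X v"
  shows "\<exists>m. count_list (take m X) v = k"
  using assms
proof (induction X arbitrary: k)
  case (Cons a X)
  show ?case
  proof (cases "a = v \<and> k > 0")
    case True
    then have "k - 1 \<le> count_list X v" using Cons.prems by auto
    then obtain m where "count_list (take m X) v = k - 1" using Cons.IH by blast
    then show ?thesis using True by (intro exI[of _ "Suc m"]) simp
  next
    case False
    show ?thesis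
    proof (cases "k = 0")
      case True
      then show ?thesis by (intro exI[of _ 0]) simp
    next
      case k: False
      then obtain m where "count_list (take m X) v = k" using Cons False by auto
      then show ?thesis using False k by (intro exI[of _ "Suc m"]) simp
    qed
  qed
qed simp

text \<open>In the unbalanced case the prefix holds \<open>h + 1\<close> majority bits, so its
  signed sum is \<open>2 * (h + 1)\<close> minus its length. As \<open>2 * (h + 1)\<close> exceeds
  \<open>length X\<close>, this is more than the number of remaining bits.\<close>

lemma unread_ok_init: "unread_ok X 0 [] (take (prefix_len X) X) (drop (prefix_len X) X)"
proof (cases "count_list X True = count_list X False")
  case True
  then show ?thesis by (simp add: unread_ok_def prefix_len_def)
next
  case False
  let ?v = "majority X" and ?Y = "take (prefix_len X) X"
  define h where "h = length X div 2"
  have h: "length X < 2 * (h + 1)" unfolding h_def by presburger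
  have "count_list X (\<not> ?v) < count_list X ?v" using False
    by (cases "count_list X False < count_list X True") (simp_all add: majority_def)
  then have "h + 1 \<le> count_list X ?v"
    using count_list_length[of X ?v] unfolding h_def by linarith
  then obtain m where "count_list (take m X) ?v = h + 1" using count_list_take_ex[of "h + 1" X ?v] by blast
  then have "count_list (take (LEAST m. count_list (take m X) ?v = h + 1) X) ?v = h + 1"
    by (rule LeastI[where P = "\<lambda>m. count_list (take m X) ?v = h + 1"])
  then have cY: "count_list ?Y ?v = h + 1" using False by (simp add: prefix_len_def h_def)
  have "int (length ?Y) + signed_sum ?v (map (Pair 0) ?Y) = 2 * (int h + 1)"
    using cY count_list_length[of ?Y ?v] by (simp add: signed_sum_count)
  moreover have "length ?Y + length (drop (prefix_len X) X) = length X"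
    by (metis append_take_drop_id length_append)
  moreover have "int b < s" if "int a + s = 2 * (int h + 1)" "a + b = length X" for a b s
    using that h by presburger
  ultimately have "int (length (drop (prefix_len X) X)) < signed_sum ?v (map (Pair 0) ?Y)"
    by blast
  also have "\<dots> \<le> \<bar>signed_sum True (map (Pair 0) ?Y)\<bar>"
    using abs_signed_sum_eq[of ?v "map (Pair 0) ?Y" True] by linarith
  finally show ?thesis by (simp add: unread_ok_def)
qed

subsection \<open>The comparison\<close>

theorem mainTheorem6:
  "\<exists>d::real. \<forall>N::nat. \<forall>X::bool list. N \<ge> 1 \<longrightarrow> length X = N \<longrightarrow>
     real (C_GP X) \<le> real (C_OP (take (prefix_len X) X)) + d * (log 2 (real N))^2"
proof (intro exI[of _ 41] allI impI)
  fix N :: nat and X :: "bool list"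
  assume N: "N \<ge> 1" "length X = N"
  show "real (C_GP X) \<le> real (C_OP (take (prefix_len X) X)) + 41 * (log 2 (real N))^2"
  \<comment> \<open>For \<open>N = 1\<close> the logarithm vanishes, so no query may occur.
    Otherwise \<open>L\<close> is at least 1 and \<open>L ^ 2\<close> absorbs the lower
    terms.\<close>
  proof (cases "N = 1")
    case True
    then have "C_GP X = 0" using N by (simp add: C_GP_def init_blocks_def)
    then show ?thesis by simp
  next
    case False
    define L where "L = nat \<lfloor>log 2 (real N)\<rfloor>"
    have "1 \<le> log 2 (real N)" using False N(1) by simp
    then have L: "1 \<le> L" "real L \<le> log 2 (real N)" unfolding L_def by linarith+
    have "length X < 2 ^ Suc L" unfolding L_def N(2) by (rule less_two_power_log)
    then have "normal_bound L X N" using gp_bounds by blast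
    from empty_bound[OF this unread_ok_init]
    have "C_GP X \<le> C_OP (take (prefix_len X) X) + potential L [] [] N"
      by (simp add: C_GP_def init_blocks_def N(2) C_OP_run_cost)
    moreover have "potential L [] [] N \<le> L + (4 * (L + 1) * (2 * (L + 1)) + 4 * (L + 1))"
      unfolding potential_def using cancel_budget_le[of L "[]" N] by simp
    \<comment> \<open>The constant 41 is the left side at \<open>L = 1\<close>, namely 1 + 32 +
      8.\<close>
    moreover have "L + (4 * (L + 1) * (2 * (L + 1)) + 4 * (L + 1)) \<le> 41 * L\<^sup>2"
    proof -
      obtain k where "L = Suc k" using L(1) by (cases L) auto
      then show ?thesis by (simp add: power2_eq_square algebra_simps)
    qed
    ultimately have "C_GP X \<le> C_OP (take (prefix_len X) X) + 41 * L\<^sup>2" by linarith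
    then have "real (C_GP X) \<le> real (C_OP (take (prefix_len X) X) + 41 * L\<^sup>2)"
      by (rule of_nat_mono)
    also have "\<dots> = real (C_OP (take (prefix_len X) X)) + 41 * (real L)\<^sup>2" by simp
    also have "(real L)\<^sup>2 \<le> (log 2 (real N))\<^sup>2" using L(2) by (intro power_mono) auto
    finally show ?thesis by simp
  qed
qed

end
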